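(* Let $k\in\mathbb{N}$. Suppose that $T$ is a strongly $(k^2+3k)$-connected tournament and that $x_1,\dots,x_k,y_1,\dots,y_k$ are vertices of $T$ such that $x_i\neq y_i$ for all $i\in[k]$ and the ordered pairs $(x_1,y_1),\dots,(x_k,y_k)$ are pairwise distinct. Then $T$ contains pairwise internally disjoint directed paths $P_1,\dots,P_k$, where $P_i$ goes from $x_i$ to $y_i$, such that $\{x_1,\dots,x_k,y_1,\dots,y_k\}\cap V(P_i)=\{x_i,y_i\}$ for each $i\in[k]$ and $V(T)=\bigcup_{i=1}^k V(P_i)$.
   Context: A digraph $G$ is strongly $k$-connected if $|G|>k$ and for every set $F\subseteq V(G)$ with $|F|<k$ and every ordered pair $x,y$ of vertices of $V(G)\setminus F$ there is a directed path from $x$ to $y$ in $G-F$. $[k]=\{1,\dots,k\}$. *)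

theory Defs
  imports Main
begin

definition tournament :: "'a set \<Rightarrow> ('a \<Rightarrow> 'a \<Rightarrow> bool) \<Rightarrow> bool" where
  "tournament V E \<longleftrightarrow> finite V
     \<and> (\<forall>u v. E u v \<longrightarrow> u \<in> V \<and> v \<in> V)
     \<and> (\<forall>v. \<not> E v v)
     \<and> (\<forall>u\<in>V. \<forall>v\<in>V. u \<noteq> v \<longrightarrow> (E u v \<longleftrightarrow> \<not> E v u))"

definition dpath :: "'a set \<Rightarrow> ('a \<Rightarrow> 'a \<Rightarrow> bool) \<Rightarrow> 'a list \<Rightarrow> bool" where
  "dpath V E P \<longleftrightarrow> P \<noteq> [] \<and> distinct P \<and> set P \<subseteq> V
     \<and> (\<forall>i. Suc i < length P \<longrightarrow> E (P ! i) (P ! Suc i))"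

definition dpath_from_to :: "'a set \<Rightarrow> ('a \<Rightarrow> 'a \<Rightarrow> bool) \<Rightarrow> 'a list \<Rightarrow> 'a \<Rightarrow> 'a \<Rightarrow> bool" where
  "dpath_from_to V E P x y \<longleftrightarrow> dpath V E P \<and> hd P = x \<and> last P = y"

definition strongly_connected_k :: "nat \<Rightarrow> 'a set \<Rightarrow> ('a \<Rightarrow> 'a \<Rightarrow> bool) \<Rightarrow> bool" where
  "strongly_connected_k k V E \<longleftrightarrow> card V > k
     \<and> (\<forall>F. F \<subseteq> V \<and> card F < k \<longrightarrow>
          (\<forall>x\<in>V - F. \<forall>y\<in>V - F. \<exists>P. dpath_from_to (V - F) E P x y))"

definition interior :: "'a list \<Rightarrow> 'a set" where
  "interior P = set (butlast (tl P))"

end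

theory Submission
  imports Defs
begin

text \<open>Let \<open>H\<close> be the tournament without the terminals, \<open>A\<^sub>i\<close> the out-neighbours of \<open>x\<^sub>i\<close> in \<open>H\<close>
  and \<open>B\<^sub>i\<close> the in-neighbours of \<open>y\<^sub>i\<close>; we look for disjoint paths from \<open>A\<^sub>i\<close> to \<open>B\<^sub>i\<close> that span
  \<open>H\<close>. They are removed one at a time. Let \<open>h v\<close> be the distance of \<open>v\<close> from the start of a shortest
  path: since all edges between levels that differ by two or more go downwards, a separator
  meets the path in at most four relevant vertices, so removing the path costs at most four in
  connectivity. The remaining danger is that a shortest path from \<open>A\<^sub>l\<close> to \<open>B\<^sub>l\<close> swallows most of
  some \<open>A\<^sub>j\<close>. Then all but the first two of the swallowed vertices dominate what is left of \<open>A\<^sub>l\<close>, so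
  this relation between \<open>l\<close> and \<open>j\<close> is antisymmetric; dually for \<open>B\<^sub>j\<close>. Averaging over \<open>l\<close>, with
  \<open>m\<close> paths to go some \<open>l\<close> swallows at most \<open>m - 1\<close> of these sets. For each of them one swallowed vertex
  is reserved as the first (or last) vertex of the \<open>j\<close>-th path, and as it dominates almost
  all of \<open>A\<^sub>l\<close> it has enough out-neighbours to continue. The last path is a Hamiltonian path of what
  remains, found as in Thomassen's theorem for \<open>k = 1\<close> from three disjoint paths.\<close>

section \<open>Tournaments, walks and connectivity\<close>

text \<open>Unlike \<open>tournament\<close>, this does not confine \<open>E\<close> to
  \<open>V\<close>, so that one fixed \<open>E\<close> serves for all vertex subsets.\<close>

definition tourn :: "'a set \<Rightarrow> ('a \<Rightarrow> 'a \<Rightarrow> bool) \<Rightarrow> bool" where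
  "tourn V E \<longleftrightarrow> finite V \<and> (\<forall>v\<in>V. \<not> E v v)
     \<and> (\<forall>u\<in>V. \<forall>v\<in>V. u \<noteq> v \<longrightarrow> (E u v \<longleftrightarrow> \<not> E v u))"

text \<open>Strong connectivity in cut form. Contradictions then come from exhibiting a vertex set
  that no edge leaves.\<close>

definition strong :: "'a set \<Rightarrow> ('a \<Rightarrow> 'a \<Rightarrow> bool) \<Rightarrow> bool" where
  "strong U E \<longleftrightarrow> (\<forall>S\<subseteq>U. S \<noteq> {} \<longrightarrow> S \<noteq> U \<longrightarrow> (\<exists>u\<in>S. \<exists>v\<in>U - S. E u v))"

definition kconn :: "nat \<Rightarrow> 'a set \<Rightarrow> ('a \<Rightarrow> 'a \<Rightarrow> bool) \<Rightarrow> bool" where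
  "kconn t V E \<longleftrightarrow> t < card V \<and> (\<forall>F\<subseteq>V. card F < t \<longrightarrow> strong (V - F) E)"

text \<open>Vertices may repeat; \<open>distinct\<close> is added separately where paths are meant.
  \<open>A\<close> and \<open>B\<close> need not lie in \<open>U\<close>.\<close>

definition walk ::
    "'a set \<Rightarrow> ('a \<Rightarrow> 'a \<Rightarrow> bool) \<Rightarrow> 'a set \<Rightarrow> 'a set \<Rightarrow> 'a list \<Rightarrow> bool" where
  "walk U E A B p \<longleftrightarrow>
     p \<noteq> [] \<and> set p \<subseteq> U \<and> successively E p \<and> hd p \<in> A \<and> last p \<in> B"

text \<open>Records what is used of a shortest walk \<open>p\<close> from \<open>A\<close> to
  \<open>B\<close> inside \<open>U\<close>: \<open>h\<close> stands for the distance from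
  \<open>A\<close>, capped at \<open>length p - 1\<close>. The last two conjuncts together put
  \<open>B \<inter> U\<close> on the top level.\<close>

definition layered ::
    "'a set \<Rightarrow> ('a \<Rightarrow> 'a \<Rightarrow> bool) \<Rightarrow> 'a set \<Rightarrow> 'a set \<Rightarrow> 'a list \<Rightarrow> ('a \<Rightarrow> nat) \<Rightarrow> bool" where
  "layered U E A B p h \<longleftrightarrow> walk U E A B p
     \<and> (\<forall>u\<in>U. \<forall>v\<in>U. E u v \<longrightarrow> h v \<le> Suc (h u))
     \<and> (\<forall>i<length p. h (p ! i) = i)
     \<and> (\<forall>u\<in>A \<inter> U. h u = 0)
     \<and> (\<forall>u\<in>B \<inter> U. length p \<le> Suc (h u))
     \<and> (\<forall>u. h u < length p)"

lemma tourn_subset: "tourn V E \<Longrightarrow> U \<subseteq> V \<Longrightarrow> tourn U E"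
  unfolding tourn_def by (auto intro: finite_subset)

lemma tourn_total: "tourn V E \<Longrightarrow> u \<in> V \<Longrightarrow> v \<in> V \<Longrightarrow> u \<noteq> v \<Longrightarrow> \<not> E u v \<Longrightarrow> E v u"
  unfolding tourn_def by blast

lemma tourn_asym: "tourn V E \<Longrightarrow> u \<in> V \<Longrightarrow> v \<in> V \<Longrightarrow> E u v \<Longrightarrow> \<not> E v u"
  unfolding tourn_def by metis

lemma walk_snoc:
  assumes "walk U E A B p" "E (last p) v" "v \<in> U"
  shows "walk U E A {v} (p @ [v])"
  using assms unfolding walk_def by (auto simp: successively_append_iff)

text \<open>No edge leaves the set of vertices reachable from \<open>A\<close> inside
  \<open>U\<close>, so it is all of \<open>U\<close>.\<close>

lemma strong_walk:
  assumes st: "strong U E" and a: "a \<in> A \<inter> U" and b: "b \<in> B \<inter> U"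
  shows "\<exists>p. walk U E A B p"
proof -
  define S where "S = {v \<in> U. \<exists>p. walk U E A {v} p}"
  have "walk U E A {a} [a]" using a by (auto simp: walk_def)
  hence aS: "a \<in> S" using a by (auto simp: S_def)
  have "S = U"
  proof (rule ccontr)
    assume "S \<noteq> U"
    then obtain u v where uv: "u \<in> S" "v \<in> U - S" "E u v"
      using st aS unfolding strong_def S_def by (metis (no_types, lifting) emptyE mem_Collect_eq subsetI)
    then obtain p where "walk U E A {u} p" by (auto simp: S_def)
    hence "walk U E A {v} (p @ [v])" using uv walk_snoc[of U E A "{u}" p v] by (auto simp: walk_def)
    thus False using uv by (auto simp: S_def)
  qed
  hence "b \<in> S" using b by auto
  thus ?thesis using b unfolding S_def walk_def by auto
qed

lemma ex_layered:
  assumes "walk U E A B p0"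
  shows "\<exists>p h. layered U E A B p h"
proof -
  obtain p where p: "walk U E A B p" and min: "\<And>q. walk U E A B q \<Longrightarrow> length p \<le> length q"
    using ex_has_least_nat[of "walk U E A B" p0 length] assms by blast
  have pne: "p \<noteq> []" using p by (simp add: walk_def)
  define N where "N = length p - 1"
  have lenp: "length p = Suc N" using pne by (cases p) (auto simp: N_def)
  \<comment> \<open>The disjunct \<open>n = N\<close> caps the distance and also gives a value to
    unreachable vertices, so that \<open>LEAST\<close> is always attained.\<close>
  define C where "C v n \<longleftrightarrow> n = N \<or> (\<exists>q. walk U E A {v} q \<and> length q = Suc n)" for v n
  define h where "h v = (LEAST n. C v n)" for v
  have Ch: "C v (h v)" for v unfolding h_def by (rule LeastI[of _ N]) (simp add: C_def)
  have hle: "C v n \<Longrightarrow> h v \<le> n" for v n unfolding h_def by (rule Least_le)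
  have hN: "h v \<le> N" for v by (rule hle) (simp add: C_def)
  have edge: "h v \<le> Suc (h u)" if "u \<in> U" "v \<in> U" "E u v" for u v
  proof (cases "h u = N")
    case True thus ?thesis using hN[of v] by simp
  next
    case False
    then obtain q where q: "walk U E A {u} q" "length q = Suc (h u)"
      using Ch[of u] by (auto simp: C_def)
    hence "walk U E A {v} (q @ [v])" using walk_snoc[of U E A "{u}" q v] that by (auto simp: walk_def)
    moreover have "length (q @ [v]) = Suc (Suc (h u))" using q by simp
    ultimately show ?thesis by (intro hle) (auto simp: C_def)
  qed
  have onp: "h (p ! i) = i" if i: "i < length p" for i
  proof (rule antisym)
    have "walk U E A {p ! i} (take (Suc i) p)"
      using p i unfolding walk_def
      by (auto simp: last_conv_nth hd_take dest: in_set_takeD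
          intro: successively_if_sorted_wrt) (metis append_take_drop_id successively_append_iff)
    thus "h (p ! i) \<le> i" using i by (intro hle) (auto simp: C_def)
  next
    show "i \<le> h (p ! i)"
    proof (cases "h (p ! i) = N")
      case True thus ?thesis using i lenp by simp
    next
      case False
      then obtain q where q: "walk U E A {p ! i} q" "length q = Suc (h (p ! i))"
        using Ch[of "p ! i"] by (auto simp: C_def)
      have split: "p = take i p @ p ! i # drop (Suc i) p" using i by (simp add: id_take_nth_drop)
      have sp: "successively E (p ! i # drop (Suc i) p)"
        using p split unfolding walk_def by (metis successively_append_iff)
      have lst: "last (p ! i # drop (Suc i) p) = last p" using split by (metis last_appendR list.discI)
      \<comment> \<open>Replacing the part of \<open>p\<close> up to \<open>p ! i\<close> by another
        walk \<open>q\<close> to the same vertex cannot make \<open>p\<close> shorter.\<close>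
      have "walk U E A B (q @ drop (Suc i) p)"
        using q p sp lst unfolding walk_def
        by (auto simp: successively_append_iff successively_Cons split: if_splits dest: in_set_dropD)
      from min[OF this] q show ?thesis using i by simp
    qed
  qed
  have "h u = 0" if "u \<in> A \<inter> U" for u
  proof -
    have "walk U E A {u} [u]" using that by (simp add: walk_def)
    hence "h u \<le> 0" by (intro hle) (auto simp: C_def intro!: exI[of _ "[u]"])
    thus ?thesis by simp
  qed
  moreover have "length p \<le> Suc (h u)" if u: "u \<in> B \<inter> U" for u
  proof (cases "h u = N")
    case True thus ?thesis using lenp by simp
  next
    case False
    then obtain q where q: "walk U E A {u} q" "length q = Suc (h u)"
      using Ch[of u] by (auto simp: C_def)
    hence "walk U E A B q" using u by (auto simp: walk_def)
    from min[OF this] q show ?thesis by simp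
  qed
  moreover have "h u < length p" for u using hN[of u] lenp by simp
  ultimately have "layered U E A B p h" using p edge onp unfolding layered_def by blast
  thus ?thesis by blast
qed

section \<open>Connectivity and degrees after deleting vertices\<close>

lemma layered_distinct: "layered U E A B p h \<Longrightarrow> distinct p"
  unfolding layered_def distinct_conv_nth by metis

lemma kconn_mono: "kconn t V E \<Longrightarrow> s \<le> t \<Longrightarrow> kconn s V E"
  unfolding kconn_def by auto

lemma kconn_remove:
  assumes "kconn t V E" "finite V" "R \<subseteq> V" "card R + s \<le> t"
  shows "kconn s (V - R) E"
  unfolding kconn_def
proof (intro conjI allI impI)
  have fR: "finite R" using assms finite_subset by blast
  show "s < card (V - R)" using assms fR unfolding kconn_def by (simp add: card_Diff_subset) linarith
  fix F assume F: "F \<subseteq> V - R" "card F < s"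
  have "finite F" using F assms finite_subset by (metis finite_Diff)
  have "card (R \<union> F) < t" using card_Un_le[of R F] F assms by linarith
  moreover have "R \<union> F \<subseteq> V" using F assms by auto
  ultimately have "strong (V - (R \<union> F)) E" using assms unfolding kconn_def by blast
  thus "strong (V - R - F) E" by (simp add: Diff_eq Int_assoc)
qed

lemma kconn_strong: "kconn t V E \<Longrightarrow> 0 < t \<Longrightarrow> strong V E"
  unfolding kconn_def by (metis Diff_empty card.empty empty_subsetI)

text \<open>If \<open>v\<close> had fewer than \<open>t\<close> out-neighbours, deleting them would
  leave \<open>v\<close> without an outgoing edge, although other vertices remain.\<close>

lemma kconn_outdegree:
  assumes "kconn t V E" "finite V" "v \<in> V" "\<not> E v v"
  shows "t \<le> card {u \<in> V. E v u}"
proof (rule ccontr)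
  let ?F = "{u \<in> V. E v u}"
  assume "\<not> ?thesis"
  hence c: "card ?F < t" by simp
  hence st: "strong (V - ?F) E" using assms unfolding kconn_def by auto
  have "v \<in> V - ?F" using assms by auto
  moreover have "{v} \<noteq> V - ?F"
  proof
    assume "{v} = V - ?F"
    hence "V \<subseteq> insert v ?F" by auto
    hence "card V \<le> card (insert v ?F)" using assms(2) by (intro card_mono) auto
    also have "\<dots> \<le> Suc (card ?F)" using assms(2) by (simp add: card_insert_if)
    finally have "card V \<le> Suc (card ?F)" .
    thus False using assms c unfolding kconn_def by simp
  qed
  ultimately have "\<exists>u\<in>{v}. \<exists>w\<in>V - ?F - {v}. E u w"
    using st[unfolded strong_def, rule_format, of "{v}"] by blast
  thus False by auto
qed

text \<open>Dually, once the in-neighbours are deleted no edge leads from the remaining vertices to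
  \<open>v\<close>.\<close>

lemma kconn_indegree:
  assumes "kconn t V E" "finite V" "v \<in> V" "\<not> E v v"
  shows "t \<le> card {u \<in> V. E u v}"
proof (rule ccontr)
  let ?F = "{u \<in> V. E u v}"
  assume "\<not> ?thesis"
  hence c: "card ?F < t" by simp
  hence st: "strong (V - ?F) E" using assms unfolding kconn_def by auto
  have v: "v \<in> V - ?F" using assms by auto
  have "V - ?F - {v} \<noteq> {}"
  proof
    assume "V - ?F - {v} = {}"
    hence "V \<subseteq> insert v ?F" by auto
    hence "card V \<le> card (insert v ?F)" using assms(2) by (intro card_mono) auto
    also have "\<dots> \<le> Suc (card ?F)" using assms(2) by (simp add: card_insert_if)
    finally show False using assms c unfolding kconn_def by simp
  qed
  moreover have "V - ?F - {v} \<noteq> V - ?F" using v by blast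
  ultimately have "\<exists>u\<in>V - ?F - {v}. \<exists>w\<in>V - ?F - (V - ?F - {v}). E u w"
    using st[unfolded strong_def, rule_format, of "V - ?F - {v}"] by blast
  thus False by auto
qed

text \<open>If no edge leaves \<open>S\<close>, then \<open>S\<close> lies at most one level above the lowest vertex \<open>y\<close> of its
  complement, and only path vertices on the four levels from \<open>h y - 1\<close> to \<open>h y + 2\<close> can bridge the two.\<close>

lemma kconn_remove_layered:
  assumes T: "tourn V E" and k: "kconn t V E" and t: "5 \<le> t"
    and p: "set p \<subseteq> V"
    and h: "\<And>u v. u \<in> V \<Longrightarrow> v \<in> V \<Longrightarrow> E u v \<Longrightarrow> h v \<le> Suc (h u)"
    and hp: "\<And>i. i < length p \<Longrightarrow> h (p ! i) = i"
  shows "kconn (t - 4) (V - set p) E"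
  unfolding kconn_def
proof (intro conjI allI impI)
  have fin: "finite V" using T by (simp add: tourn_def)
  have inj: "inj_on h (set p)"
    by (metis hp in_set_conv_nth inj_onI)
  show "t - 4 < card (V - set p)"
  proof (cases "length p \<le> 4")
    case True
    have "card (V - set p) = card V - card (set p)" using p fin by (intro card_Diff_subset) auto
    moreover have "card (set p) \<le> 4" using True card_length[of p] by simp
    ultimately show ?thesis using k t unfolding kconn_def by linarith
  next
    case False
    \<comment> \<open>A long path is not counted vertex by vertex: of the \<open>t\<close> or more
      out-neighbours of its first vertex only \<open>p ! 1\<close> can lie on the path, since the
      later vertices are two or more levels up.\<close>
    let ?N = "{u \<in> V. E (p ! 0) u}"
    have p0: "p ! 0 \<in> V" using False by (intro subsetD[OF p] nth_mem) linarith
    have sub: "?N \<inter> set p \<subseteq> {p ! 1}"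
    proof
      fix u assume u: "u \<in> ?N \<inter> set p"
      then obtain i where i: "i < length p" "u = p ! i" by (auto simp: in_set_conv_nth)
      have "h u \<le> Suc (h (p ! 0))" using u p0 h by auto
      moreover have "h (p ! 0) = 0" using hp[of 0] False by linarith
      ultimately have "i \<le> 1" using hp[of i] i by simp
      moreover have "i \<noteq> 0" using u i p0 T unfolding tourn_def by (metis IntD1 mem_Collect_eq)
      ultimately have "i = 1" by simp
      thus "u \<in> {p ! 1}" using i by simp
    qed
    have "t \<le> card ?N" using kconn_outdegree[OF k fin p0] T p0 by (auto simp: tourn_def)
    also have "\<dots> \<le> card ((V - set p) \<union> {p ! 1})" using sub fin by (intro card_mono) auto
    also have "\<dots> \<le> card (V - set p) + 1" using card_Un_le[of "V - set p" "{p ! 1}"] by simp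
    finally show ?thesis using t by simp
  qed
  fix F assume F: "F \<subseteq> V - set p" "card F < t - 4"
  have fF: "finite F" using F fin by (meson finite_Diff finite_subset)
  show "strong (V - set p - F) E"
    unfolding strong_def
  proof (intro allI impI, rule ccontr)
    fix S assume S: "S \<subseteq> V - set p - F" "S \<noteq> {}" "S \<noteq> V - set p - F"
      and noedge: "\<not> (\<exists>u\<in>S. \<exists>v\<in>V - set p - F - S. E u v)"
    define Y where "Y = V - set p - F - S"
    have "Y \<noteq> {}" using S by (auto simp: Y_def)
    then obtain y where y: "y \<in> Y" and ymin: "\<And>v. v \<in> Y \<Longrightarrow> h y \<le> h v"
      using ex_has_least_nat[of "\<lambda>v. v \<in> Y" _ h] by blast
    have hS: "h x \<le> Suc (h y)" if "x \<in> S" for x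
    proof -
      have "\<not> E x y" using noedge that y by (auto simp: Y_def)
      hence "E y x" using T that y S by (intro tourn_total[OF T, of x y]) (auto simp: Y_def)
      thus ?thesis using h that y S by (auto simp: Y_def)
    qed
    \<comment> \<open>These path vertices are deleted together with \<open>F\<close>. As
      \<open>h\<close> is injective on \<open>p\<close> there are at most four, so fewer than
      \<open>t\<close> vertices are deleted altogether.\<close>
    define P' where "P' = {v \<in> set p. h y \<le> Suc (h v) \<and> h v \<le> h y + 2}"
    have "h ` P' \<subseteq> {h y - 1..h y + 2}" by (auto simp: P'_def)
    hence "card (h ` P') \<le> card {h y - 1..h y + 2}" by (intro card_mono) auto
    moreover have "card (h ` P') = card P'"
      by (intro card_image inj_on_subset[OF inj]) (auto simp: P'_def)
    ultimately have cP: "card P' \<le> 4" by auto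
    have "card (F \<union> P') < t" using cP F card_Un_le[of F P'] by linarith
    moreover have "F \<union> P' \<subseteq> V" using F p by (auto simp: P'_def)
    ultimately have st: "strong (V - (F \<union> P')) E" using k by (auto simp: kconn_def)
    \<comment> \<open>\<open>I\<close> adds to \<open>S\<close> the path vertices below the deleted
      levels. An edge leaving \<open>I\<close> cannot end in \<open>Y\<close>: none comes from
      \<open>S\<close>, and the low path vertices reach at most level \<open>h y - 1\<close>. Nor
      can it end on the path above level \<open>h y + 2\<close>, because all of \<open>I\<close>
      lies on levels up to \<open>h y + 1\<close>.\<close>
    define I where "I = S \<union> {v \<in> set p. h v + 2 \<le> h y}"
    have IU: "I \<subseteq> V - (F \<union> P')" using S p F by (auto simp: I_def P'_def)
    have "y \<in> V - (F \<union> P')" "y \<notin> I" using y by (auto simp: I_def P'_def Y_def)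
    hence "I \<noteq> V - (F \<union> P')" by blast
    moreover have "I \<noteq> {}" using S by (auto simp: I_def)
    ultimately obtain u v where uv: "u \<in> I" "v \<in> V - (F \<union> P') - I" "E u v"
      using st IU unfolding strong_def by meson
    have uV: "u \<in> V" using uv IU by auto
    have hv: "h v \<le> Suc (h u)" using h uv uV by auto
    consider "v \<in> Y" | "v \<in> set p" "\<not> h v + 2 \<le> h y" "\<not> (h y \<le> Suc (h v) \<and> h v \<le> h y + 2)"
      using uv by (auto simp: I_def P'_def Y_def)
    thus False
    proof cases
      case 1
      hence "u \<notin> S" using uv noedge by (auto simp: Y_def)
      hence "h u + 2 \<le> h y" using uv by (auto simp: I_def)
      thus False using hv ymin[OF 1] by simp
    next
      case 2
      have "h u \<le> Suc (h y)" using uv hS by (auto simp: I_def)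
      thus False using 2 hv by linarith
    qed
  qed
qed

section \<open>Menger's theorem\<close>

definition linkage ::
    "('a \<Rightarrow> 'a \<Rightarrow> bool) \<Rightarrow> 'a set \<Rightarrow> 'a set \<Rightarrow> nat \<Rightarrow> 'a list set \<Rightarrow> bool" where
  "linkage E A B n \<P> \<longleftrightarrow> finite \<P> \<and> card \<P> = n
     \<and> (\<forall>p\<in>\<P>. walk UNIV E A B p \<and> distinct p)
     \<and> (\<forall>p\<in>\<P>. \<forall>q\<in>\<P>. p \<noteq> q \<longrightarrow> set p \<inter> set q = {})"

definition separates :: "('a \<Rightarrow> 'a \<Rightarrow> bool) \<Rightarrow> 'a set \<Rightarrow> 'a set \<Rightarrow> 'a set \<Rightarrow> bool" where
  "separates E A B S \<longleftrightarrow> (\<forall>p. walk UNIV E A B p \<longrightarrow> set p \<inter> S \<noteq> {})"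

text \<open>Allows a walk to be cut just before it first uses the new edge
  \<open>(x, y)\<close>.\<close>

lemma successively_first_use:
  assumes "successively (\<lambda>u v. (u, v) \<in> insert (x, y) G) p"
  shows "successively (\<lambda>u v. (u, v) \<in> G) p
    \<or> (\<exists>p1 p2. p = p1 @ x # y # p2 \<and> successively (\<lambda>u v. (u, v) \<in> G) (p1 @ [x]))"
  using assms
proof (induction p)
  case (Cons a p)
  show ?case
  proof (cases p)
    case (Cons b q)
    show ?thesis
    proof (cases "(a, b) \<in> G")
      case True
      have "successively (\<lambda>u v. (u, v) \<in> insert (x, y) G) p"
        using Cons.prems by (auto simp: successively_Cons)
      from Cons.IH[OF this] show ?thesis
      proof (elim disjE exE conjE)
        fix p1 p2 assume p: "p = p1 @ x # y # p2" "successively (\<lambda>u v. (u, v) \<in> G) (p1 @ [x])"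
        hence "successively (\<lambda>u v. (u, v) \<in> G) ((a # p1) @ [x])"
          using True Cons by (cases p1) auto
        thus ?thesis using p by (metis append_Cons)
      qed (use True Cons in auto)
    next
      case False
      hence "a = x" "b = y" using Cons.prems Cons by auto
      thus ?thesis using Cons by (intro disjI2 exI[of _ "[]"] exI[of _ q]) auto
    qed
  qed simp
qed simp

lemma successively_last_use:
  assumes "successively (\<lambda>u v. (u, v) \<in> insert (x, y) G) p"
  shows "successively (\<lambda>u v. (u, v) \<in> G) p
    \<or> (\<exists>p1 p2. p = p1 @ x # y # p2 \<and> successively (\<lambda>u v. (u, v) \<in> G) (y # p2))"
  using assms
proof (induction p)
  case (Cons a p)
  have "successively (\<lambda>u v. (u, v) \<in> insert (x, y) G) p"
    using Cons.prems by (auto simp: successively_Cons)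
  from Cons.IH[OF this] show ?case
  proof (elim disjE exE conjE)
    assume p: "successively (\<lambda>u v. (u, v) \<in> G) p"
    show ?thesis
    proof (cases "p = [] \<or> (a, hd p) \<in> G")
      case True thus ?thesis using p by (auto simp: successively_Cons)
    next
      case False
      hence "a = x" "hd p = y" "p \<noteq> []" using Cons.prems by (auto simp: successively_Cons)
      thus ?thesis using p by (intro disjI2 exI[of _ "[]"] exI[of _ "tl p"]) auto
    qed
  next
    fix p1 p2 assume "p = p1 @ x # y # p2" "successively (\<lambda>u v. (u, v) \<in> G) (y # p2)"
    thus ?thesis by (metis append_Cons)
  qed
qed simp

text \<open>Every walk from \<open>A\<close> to \<open>B\<close> has an initial part inside
  \<open>G\<close> that ends in \<open>insert x S\<close>: if it avoids the new edge it meets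
  \<open>S\<close>, otherwise it is cut at the first use of that edge.\<close>

lemma separates_prefix:
  assumes S: "separates (\<lambda>u v. (u, v) \<in> G) A B S"
    and S': "separates (\<lambda>u v. (u, v) \<in> G) A (insert x S) S'"
  shows "separates (\<lambda>u v. (u, v) \<in> insert (x, y) G) A B S'"
  unfolding separates_def
proof (intro allI impI)
  fix p assume p: "walk UNIV (\<lambda>u v. (u, v) \<in> insert (x, y) G) A B p"
  have "\<exists>p1 v p2. p = p1 @ v # p2 \<and> v \<in> insert x S \<and> successively (\<lambda>u v. (u, v) \<in> G) (p1 @ [v])"
  proof (cases "successively (\<lambda>u v. (u, v) \<in> G) p")
    case True
    hence "walk UNIV (\<lambda>u v. (u, v) \<in> G) A B p" using p by (simp add: walk_def)
    then obtain v where v: "v \<in> set p" "v \<in> S" using S by (auto simp: separates_def)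
    then obtain p1 p2 where eq: "p = p1 @ v # p2" by (metis split_list)
    hence "p = (p1 @ [v]) @ p2" by simp
    hence "successively (\<lambda>u v. (u, v) \<in> G) (p1 @ [v])"
      using True by (metis successively_append_iff)
    thus ?thesis using eq v by blast
  next
    case False
    thus ?thesis using successively_first_use[of x y G p] p by (auto simp: walk_def)
  qed
  then obtain p1 v p2 where p1: "p = p1 @ v # p2" "v \<in> insert x S"
    "successively (\<lambda>u v. (u, v) \<in> G) (p1 @ [v])" by blast
  hence "walk UNIV (\<lambda>u v. (u, v) \<in> G) A (insert x S) (p1 @ [v])"
    using p unfolding walk_def by (cases p1) auto
  hence "set (p1 @ [v]) \<inter> S' \<noteq> {}" using S' unfolding separates_def by blast
  thus "set p \<inter> S' \<noteq> {}" using p1 by auto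
qed

text \<open>Mirror image: the walk is cut after the last use of the new edge.\<close>

lemma separates_suffix:
  assumes S: "separates (\<lambda>u v. (u, v) \<in> G) A B S"
    and S': "separates (\<lambda>u v. (u, v) \<in> G) (insert y S) B S'"
  shows "separates (\<lambda>u v. (u, v) \<in> insert (x, y) G) A B S'"
  unfolding separates_def
proof (intro allI impI)
  fix p assume p: "walk UNIV (\<lambda>u v. (u, v) \<in> insert (x, y) G) A B p"
  have "\<exists>p1 v p2. p = p1 @ v # p2 \<and> v \<in> insert y S \<and> successively (\<lambda>u v. (u, v) \<in> G) (v # p2)"
  proof (cases "successively (\<lambda>u v. (u, v) \<in> G) p")
    case True
    hence "walk UNIV (\<lambda>u v. (u, v) \<in> G) A B p" using p by (simp add: walk_def)
    then obtain v where v: "v \<in> set p" "v \<in> S" using S by (auto simp: separates_def)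
    then obtain p1 p2 where eq: "p = p1 @ v # p2" by (metis split_list)
    hence "successively (\<lambda>u v. (u, v) \<in> G) (v # p2)"
      using True by (metis successively_append_iff)
    thus ?thesis using eq v by blast
  next
    case False
    then obtain p1 p2 where "p = p1 @ x # y # p2" "successively (\<lambda>u v. (u, v) \<in> G) (y # p2)"
      using successively_last_use[of x y G p] p by (auto simp: walk_def)
    thus ?thesis by (intro exI[of _ "p1 @ [x]"] exI[of _ y] exI[of _ p2]) auto
  qed
  then obtain p1 v p2 where p1: "p = p1 @ v # p2" "v \<in> insert y S"
    "successively (\<lambda>u v. (u, v) \<in> G) (v # p2)" by blast
  hence "walk UNIV (\<lambda>u v. (u, v) \<in> G) (insert y S) B (v # p2)"
    using p unfolding walk_def by auto
  hence "set (v # p2) \<inter> S' \<noteq> {}" using S' unfolding separates_def by blast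
  thus "set p \<inter> S' \<noteq> {}" using p1 by auto
qed

text \<open>\<open>e\<close> stands for \<open>hd\<close> or \<open>last\<close>. Disjointness makes
  it injective on the paths, so by counting it is a bijection onto \<open>D\<close>, and the paths
  can be indexed by their ends in \<open>D\<close>.\<close>

lemma linkage_ends:
  assumes L: "linkage E A B n \<P>" and e: "\<And>p. p \<in> \<P> \<Longrightarrow> e p \<in> set p \<inter> D"
    and D: "finite D" "card D = n"
  shows "\<exists>f. (\<forall>s\<in>D. f s \<in> \<P> \<and> e (f s) = s \<and> set (f s) \<inter> D = {s})"
proof -
  have inj: "inj_on e \<P>"
  proof (rule inj_onI)
    fix p q assume pq: "p \<in> \<P>" "q \<in> \<P>" "e p = e q"
    hence "e p \<in> set p \<inter> set q" using e[of p] e[of q] by auto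
    thus "p = q" using L pq unfolding linkage_def by blast
  qed
  have "card (e ` \<P>) = card D" using inj L D by (simp add: card_image linkage_def)
  hence im: "e ` \<P> = D" using e D by (intro card_subset_eq) auto
  define f where "f = the_inv_into \<P> e"
  have f: "f s \<in> \<P>" "e (f s) = s" if "s \<in> D" for s
    using that inj im unfolding f_def
    by (auto intro: the_inv_into_into f_the_inv_into_f)
  have "t = s" if "s \<in> D" "t \<in> D" "t \<in> set (f s)" for s t
  proof -
    have "t \<in> set (f t)" using f[OF that(2)] e by (metis IntD1)
    hence "f s = f t" using that f L unfolding linkage_def by blast
    thus ?thesis using f that by metis
  qed
  moreover have "s \<in> set (f s)" if "s \<in> D" for s using f[OF that] e by (metis IntD1)
  ultimately have "\<forall>s\<in>D. f s \<in> \<P> \<and> e (f s) = s \<and> set (f s) \<inter> D = {s}"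
    using f by blast
  thus ?thesis by blast
qed

text \<open>Goering's proof: delete an edge \<open>(x, y)\<close>; a small separator \<open>S\<close> of what remains
  becomes a separator of the whole digraph by adding \<open>x\<close> or \<open>y\<close>, and linkages into
  \<open>S \<union> {x}\<close> and out of \<open>S \<union> {y}\<close> meet only in \<open>S\<close>.\<close>

theorem menger:
  fixes G :: "('a \<times> 'a) set"
  assumes "finite G" "finite A" "finite B"
    and "\<And>S. finite S \<Longrightarrow> separates (\<lambda>u v. (u, v) \<in> G) A B S \<Longrightarrow> n \<le> card S"
  shows "\<exists>\<P>. linkage (\<lambda>u v. (u, v) \<in> G) A B n \<P>"
  using assms
proof (induction G arbitrary: A B rule: finite_induct)
  case empty
  \<comment> \<open>Without edges, a walk from \<open>A\<close> to \<open>B\<close> is a single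
    vertex of \<open>A \<inter> B\<close>.\<close>
  have "separates (\<lambda>u v. (u, v) \<in> {}) A B (A \<inter> B)"
    unfolding separates_def
  proof (intro allI impI)
    fix p assume p: "walk UNIV (\<lambda>u v. (u, v) \<in> {}) A B p"
    then obtain a q where "p = a # q" by (cases p) (auto simp: walk_def)
    thus "set p \<inter> (A \<inter> B) \<noteq> {}" using p by (cases q) (auto simp: walk_def)
  qed
  hence "n \<le> card (A \<inter> B)" using empty by blast
  then obtain C where C: "C \<subseteq> A \<inter> B" "card C = n" "finite C"
    using obtain_subset_with_card_n by metis
  have "linkage (\<lambda>u v. (u, v) \<in> {}) A B n ((\<lambda>a. [a]) ` C)"
    using C unfolding linkage_def by (auto simp: card_image inj_on_def walk_def)
  thus ?case by blast
next
  case (insert e G)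
  obtain x y where e: "e = (x, y)" by (cases e)
  let ?E = "\<lambda>u v. (u, v) \<in> G" and ?E' = "\<lambda>u v. (u, v) \<in> insert e G"
  have mono: "walk UNIV ?E C D p \<Longrightarrow> walk UNIV ?E' C D p" for C D p
    unfolding walk_def by (auto elim: successively_mono)
  show ?case
  proof (cases "\<exists>S. finite S \<and> separates ?E A B S \<and> card S < n")
    case False
    hence "\<exists>\<P>. linkage ?E A B n \<P>" using insert by (meson linorder_not_less)
    thus ?thesis using mono unfolding linkage_def by blast
  next
    case True
    then obtain S where S: "finite S" "separates ?E A B S" "card S < n" by blast
    have sx: "n \<le> card S'" if "finite S'" "separates ?E A (insert x S) S'" for S'
      using separates_prefix[OF S(2) that(2)] that(1) insert.prems(3) unfolding e by blast
    have sy: "n \<le> card S'" if "finite S'" "separates ?E (insert y S) B S'" for S'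
      using separates_suffix[OF S(2) that(2)] that(1) insert.prems(3) unfolding e by blast
    \<comment> \<open>Each enlarged set separates itself from the other side, so it has at least
      \<open>n\<close> elements; since \<open>card S < n\<close>, it has exactly
      \<open>n\<close>.\<close>
    have "separates ?E A (insert x S) (insert x S)" "separates ?E (insert y S) B (insert y S)"
      unfolding separates_def walk_def by (metis disjoint_iff last_in_set, metis disjoint_iff hd_in_set)
    hence c: "n \<le> card (insert x S)" "n \<le> card (insert y S)" using sx sy S by auto
    have xS: "x \<notin> S" and yS: "y \<notin> S" using c S by (auto simp: insert_absorb)
    hence cx: "card (insert x S) = n" and cy: "card (insert y S) = n" using c S by auto
    obtain \<P> where P: "linkage ?E A (insert x S) n \<P>"
      using insert.IH[of A "insert x S"] insert.prems sx S by blast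
    obtain \<Q> where Q: "linkage ?E (insert y S) B n \<Q>"
      using insert.IH[of "insert y S" B] insert.prems sy S by blast
    obtain f where f: "\<And>s. s \<in> insert x S \<Longrightarrow> f s \<in> \<P> \<and> last (f s) = s \<and> set (f s) \<inter> insert x S = {s}"
      using linkage_ends[OF P, of last "insert x S"] P S cx
      by (auto simp: linkage_def walk_def) (metis last_in_set)
    obtain g where g: "\<And>s. s \<in> insert y S \<Longrightarrow> g s \<in> \<Q> \<and> hd (g s) = s \<and> set (g s) \<inter> insert y S = {s}"
      using linkage_ends[OF Q, of hd "insert y S"] Q S cy
      by (auto simp: linkage_def walk_def) (metis hd_in_set)
    have fw: "walk UNIV ?E A {s} (f s)" "distinct (f s)" if "s \<in> insert x S" for s
      using f[OF that] P that unfolding linkage_def walk_def by blast+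
    have gw: "walk UNIV ?E {s} B (g s)" "distinct (g s)" if "s \<in> insert y S" for s
      using g[OF that] Q that unfolding linkage_def walk_def by blast+
    have fd: "set (f s) \<inter> set (f t) = {}" if "s \<in> insert x S" "t \<in> insert x S" "s \<noteq> t" for s t
      using f[OF that(1)] f[OF that(2)] P that(3) unfolding linkage_def by metis
    have gd: "set (g s) \<inter> set (g t) = {}" if "s \<in> insert y S" "t \<in> insert y S" "s \<noteq> t" for s t
      using g[OF that(1)] g[OF that(2)] Q that(3) unfolding linkage_def by metis
    \<comment> \<open>Following \<open>f s\<close> up to \<open>v\<close> and then
      \<open>g t\<close> gives a walk from \<open>A\<close> to \<open>B\<close> in \<open>G\<close>,
      which must meet \<open>S\<close>. As \<open>f s\<close> meets \<open>insert x S\<close> only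
      at its end and \<open>g t\<close> meets \<open>insert y S\<close> only at its start, the
      meeting point can only be \<open>v\<close>.\<close>
    have cross: "v \<in> S \<and> v = s \<and> v = t"
      if s: "s \<in> insert x S" and t: "t \<in> insert y S" and v: "v \<in> set (f s)" "v \<in> set (g t)" for s t v
    proof -
      obtain p1 p2 where p: "f s = p1 @ v # p2" using v by (meson split_list)
      obtain q1 q2 where q: "g t = q1 @ v # q2" using v by (meson split_list)
      have "f s = (p1 @ [v]) @ p2" using p by simp
      hence "successively ?E (p1 @ [v])"
        using fw[OF s] unfolding walk_def by (metis successively_append_iff)
      moreover have "successively ?E (v # q2)"
        using gw[OF t] q unfolding walk_def by (metis successively_append_iff)
      ultimately have "successively ?E (p1 @ v # q2)"
        by (auto simp: successively_append_iff successively_Cons)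
      moreover have "hd (p1 @ v # q2) \<in> A" using fw(1)[OF s] p by (cases p1) (auto simp: walk_def)
      moreover have "last (p1 @ v # q2) \<in> B" using gw(1)[OF t] q by (auto simp: walk_def)
      ultimately have "walk UNIV ?E A B (p1 @ v # q2)" by (simp add: walk_def)
      then obtain w where w: "w \<in> S" "w \<in> set (p1 @ v # q2)"
        using S(2) unfolding separates_def by blast
      have "v \<in> S"
      proof (cases "w \<in> set q2")
        case True
        hence "w = t" using g[OF t] q w by auto
        hence "hd (q1 @ v # q2) = w" using g[OF t] q by metis
        thus ?thesis using True gw(2)[OF t] q by (cases q1) auto
      next
        case False
        hence w': "w \<in> set (p1 @ [v])" using w by auto
        hence "w = s" using f[OF s] p w by auto
        hence "last (v # p2) = w" using f[OF s] p by (metis last_appendR list.distinct(1))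
        hence "w \<notin> set p1" using fw(2)[OF s] p by (metis disjoint_iff distinct_append last_in_set list.distinct(1))
        thus ?thesis using w' w by auto
      qed
      thus ?thesis using f[OF s] g[OF t] v by auto
    qed
    \<comment> \<open>For \<open>s = x\<close> the new edge \<open>(x, y)\<close> joins the two
      paths; all other pairs share the vertex \<open>s\<close>, which \<open>tl\<close> removes
      once.\<close>
    define R where "R s = (if s = x then f x @ g y else f s @ tl (g s))" for s
    have hdg: "g s = s # tl (g s)" if "s \<in> insert y S" for s
      using g[OF that] gw[OF that] unfolding walk_def by (metis list.collapse)
    have setR: "set (R s) = set (f s) \<union> set (g (if s = x then y else s))" if s: "s \<in> insert x S" for s
    proof (cases "s = x")
      case False
      hence "s \<in> insert y S" using s by auto
      moreover have "s \<in> set (f s)" using f[OF s] by auto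
      moreover from calculation(1) have "set (g s) = insert s (set (tl (g s)))"
        using arg_cong[OF hdg, of s set] by simp
      ultimately show ?thesis using False by (auto simp: R_def)
    qed (simp add: R_def)
    have Rdisj: "set (R s) \<inter> set (R t) = {}" if st: "s \<in> insert x S" "t \<in> insert x S" "s \<noteq> t" for s t
    proof -
      let ?a = "if s = x then y else s" and ?b = "if t = x then y else t"
      have ab: "?a \<in> insert y S" "?b \<in> insert y S" "?a \<noteq> ?b" using st yS by auto
      have "set (f s) \<inter> set (g ?b) = {}" using cross[OF st(1) ab(2)] st(3) yS by (metis disjoint_iff)
      moreover have "set (f t) \<inter> set (g ?a) = {}" using cross[OF st(2) ab(1)] st(3) yS by (metis disjoint_iff)
      ultimately show ?thesis using setR[OF st(1)] setR[OF st(2)] fd[OF st] gd[OF ab] by blast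
    qed
    have Rw: "walk UNIV ?E' A B (R s) \<and> distinct (R s)" if s: "s \<in> insert x S" for s
    proof (cases "s = x")
      case True
      have "(last (f x), hd (g y)) \<in> insert e G" using f[of x] g[of y] e by simp
      moreover have "set (f x) \<inter> set (g y) = {}" using cross[of x y] xS by auto
      ultimately show ?thesis
        using True mono[OF fw(1)[of x]] mono[OF gw(1)[of y]] fw(2)[of x] gw(2)[of y]
        unfolding R_def walk_def by (auto simp: successively_append_iff)
    next
      case False
      hence sS: "s \<in> S" "s \<in> insert y S" using s by auto
      have tl: "set (g s) = insert s (set (tl (g s)))" "s \<notin> set (tl (g s))"
        using arg_cong[OF hdg[OF sS(2)], of set] arg_cong[OF hdg[OF sS(2)], of distinct] gw(2)[OF sS(2)]
        by auto
      have "set (f s) \<inter> set (g s) \<subseteq> {s}" using cross[OF s sS(2)] by auto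
      hence "set (f s) \<inter> set (tl (g s)) = {}" using tl by blast
      moreover have "walk UNIV ?E' {s} B (s # tl (g s))" using mono[OF gw(1)[OF sS(2)]] hdg[OF sS(2)] by simp
      moreover have "distinct (tl (g s))" using gw(2)[OF sS(2)] by (rule distinct_tl)
      ultimately show ?thesis
        using False mono[OF fw(1)[OF s]] fw(2)[OF s]
        unfolding R_def walk_def
        by (auto simp: successively_append_iff successively_Cons split: if_splits)
    qed
    have "inj_on R (insert x S)"
      using Rdisj Rw unfolding inj_on_def walk_def by (metis Int_absorb set_empty)
    hence "card (R ` insert x S) = n" using cx card_image by metis
    moreover have "\<forall>p\<in>R ` insert x S. \<forall>q\<in>R ` insert x S. p \<noteq> q \<longrightarrow> set p \<inter> set q = {}"
      using Rdisj by blast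
    ultimately have "linkage ?E' A B n (R ` insert x S)"
      using Rw S unfolding linkage_def by blast
    thus ?thesis by blast
  qed
qed

lemma three_disjoint_paths:
  assumes "finite V" "A \<subseteq> V" "B \<subseteq> V"
    and conn: "\<And>S. S \<subseteq> V \<Longrightarrow> card S < 3 \<Longrightarrow> \<exists>p. walk (V - S) E A B p"
  shows "\<exists>P Q R. (\<forall>p\<in>{P, Q, R}. walk V E A B p \<and> distinct p)
    \<and> set P \<inter> set Q = {} \<and> set P \<inter> set R = {} \<and> set Q \<inter> set R = {}"
proof -
  define G where "G = {(u, v). u \<in> V \<and> v \<in> V \<and> E u v}"
  have fG: "finite G" unfolding G_def
    by (rule finite_subset[of _ "V \<times> V"]) (use assms in auto)
  have "3 \<le> card S" if S: "finite S" "separates (\<lambda>u v. (u, v) \<in> G) A B S" for S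
  proof (rule ccontr)
    assume "\<not> 3 \<le> card S"
    \<comment> \<open>Separators in \<open>menger\<close> are arbitrary finite sets, hence the
      restriction to \<open>V\<close>.\<close>
    hence "card (S \<inter> V) < 3" using S by (metis Int_lower1 card_mono leD le_less_trans linorder_not_less)
    then obtain p where p: "walk (V - S \<inter> V) E A B p" using conn[of "S \<inter> V"] by auto
    have "successively (\<lambda>u v. (u, v) \<in> G) p"
      using p unfolding walk_def G_def by (auto elim!: successively_mono)
    hence "walk UNIV (\<lambda>u v. (u, v) \<in> G) A B p" using p by (simp add: walk_def)
    hence "set p \<inter> S \<noteq> {}" using S by (auto simp: separates_def)
    thus False using p by (auto simp: walk_def)
  qed
  then obtain \<P> where P: "linkage (\<lambda>u v. (u, v) \<in> G) A B 3 \<P>"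
    using menger[OF fG, of A B 3] assms finite_subset by metis
  then obtain P Q R where PQR: "\<P> = {P, Q, R}" "P \<noteq> Q" "P \<noteq> R" "Q \<noteq> R"
    unfolding linkage_def by (metis card_3_iff)
  have "walk V E A B p" if "p \<in> \<P>" for p
  proof -
    have w: "walk UNIV (\<lambda>u v. (u, v) \<in> G) A B p" using P that by (simp add: linkage_def)
    have "set p \<subseteq> V"
    proof (cases p)
      case (Cons a q)
      have "successively (\<lambda>u v. (u, v) \<in> G) (a # q) \<Longrightarrow> a \<in> V \<Longrightarrow> set (a # q) \<subseteq> V" for a q
        by (induction q arbitrary: a) (auto simp: G_def)
      thus ?thesis using w Cons assms unfolding walk_def by auto
    qed simp
    moreover have "successively E p" using w unfolding walk_def G_def by (auto elim!: successively_mono)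
    ultimately show ?thesis using w by (simp add: walk_def)
  qed
  thus ?thesis using P PQR unfolding linkage_def
    by (intro exI[of _ P] exI[of _ Q] exI[of _ R]) auto
qed

section \<open>Hamiltonian paths\<close>

text \<open>Works like the merging of sorted lists: of the two first vertices, the one that
  dominates the other comes first.\<close>

lemma merge_paths:
  assumes "tourn V E" "set p \<subseteq> V" "set q \<subseteq> V" "set p \<inter> set q = {}" "p \<noteq> []" "q \<noteq> []"
    and "successively E p" "successively E q" "distinct p" "distinct q"
  shows "\<exists>r. set r = set p \<union> set q \<and> distinct r \<and> successively E r \<and> r \<noteq> []
    \<and> hd r \<in> {hd p, hd q} \<and> last r \<in> {last p, last q}"
  using assms(2-)
proof (induction "length p + length q" arbitrary: p q rule: less_induct)
  case less
  \<comment> \<open>The induction hypothesis is a premise, so that the claim also applies with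
    \<open>p\<close> and \<open>q\<close> exchanged.\<close>
  have *: "\<exists>r. set r = set p \<union> set q \<and> distinct r \<and> successively E r \<and> r \<noteq> []
      \<and> hd r \<in> {hd p, hd q} \<and> last r \<in> {last p, last q}"
    if IH: "\<And>p' q'. length p' + length q' < length p + length q \<Longrightarrow> set p' \<subseteq> V \<Longrightarrow> set q' \<subseteq> V \<Longrightarrow>
        set p' \<inter> set q' = {} \<Longrightarrow> p' \<noteq> [] \<Longrightarrow> q' \<noteq> [] \<Longrightarrow> successively E p' \<Longrightarrow> successively E q' \<Longrightarrow>
        distinct p' \<Longrightarrow> distinct q' \<Longrightarrow>
        \<exists>r. set r = set p' \<union> set q' \<and> distinct r \<and> successively E r \<and> r \<noteq> []
          \<and> hd r \<in> {hd p', hd q'} \<and> last r \<in> {last p', last q'}"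
      and p: "set p \<subseteq> V" "set q \<subseteq> V" "set p \<inter> set q = {}" "p \<noteq> []" "q \<noteq> []"
        "successively E p" "successively E q" "distinct p" "distinct q" "E (hd p) (hd q)" for p q
  proof -
    obtain a p' where ap: "p = a # p'" using p by (cases p) auto
    show ?thesis
    proof (cases "p' = []")
      case True
      thus ?thesis using p ap by (intro exI[of _ "a # q"]) (auto simp: successively_Cons)
    next
      case False
      obtain r where r: "set r = set p' \<union> set q" "distinct r" "successively E r" "r \<noteq> []"
        "hd r \<in> {hd p', hd q}" "last r \<in> {last p', last q}"
        using IH[of p' q] p ap False by (auto simp: successively_Cons)
      have "E a (hd r)" using r p ap False by (auto simp: successively_Cons)
      thus ?thesis using r p ap False by (intro exI[of _ "a # r"]) (auto simp: successively_Cons)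
    qed
  qed
  have "hd p \<noteq> hd q" using less.prems by (metis disjoint_iff hd_in_set)
  hence "E (hd p) (hd q) \<or> E (hd q) (hd p)"
    using tourn_total[OF assms(1)] less.prems by (meson hd_in_set subsetD)
  thus ?case
  proof
    assume "E (hd p) (hd q)"
    thus ?thesis using *[of p q] less by blast
  next
    assume e: "E (hd q) (hd p)"
    have IH': "\<And>p' q'. length p' + length q' < length q + length p \<Longrightarrow> set p' \<subseteq> V \<Longrightarrow> set q' \<subseteq> V \<Longrightarrow>
        set p' \<inter> set q' = {} \<Longrightarrow> p' \<noteq> [] \<Longrightarrow> q' \<noteq> [] \<Longrightarrow> successively E p' \<Longrightarrow> successively E q' \<Longrightarrow>
        distinct p' \<Longrightarrow> distinct q' \<Longrightarrow>
        \<exists>r. set r = set p' \<union> set q' \<and> distinct r \<and> successively E r \<and> r \<noteq> []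
          \<and> hd r \<in> {hd p', hd q'} \<and> last r \<in> {last p', last q'}"
      using less.hyps by (simp add: add.commute)
    have "\<exists>r. set r = set q \<union> set p \<and> distinct r \<and> successively E r \<and> r \<noteq> []
      \<and> hd r \<in> {hd q, hd p} \<and> last r \<in> {last q, last p}"
      by (rule *[OF IH']) (use less.prems e in auto)
    thus ?thesis by (metis Un_commute insert_commute)
  qed
qed

lemma merge_walks:
  assumes "tourn V E" "set p \<inter> set q = {}"
    and "walk V E A B p" "distinct p" "walk V E A B q" "distinct q"
  shows "\<exists>r. walk V E A B r \<and> distinct r \<and> set r = set p \<union> set q"
proof -
  obtain r where "set r = set p \<union> set q" "distinct r" "successively E r" "r \<noteq> []"
    "hd r \<in> {hd p, hd q}" "last r \<in> {last p, last q}"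
    using merge_paths[of V E p q] assms unfolding walk_def by blast
  thus ?thesis using assms unfolding walk_def by (intro exI[of _ r]) auto
qed

section \<open>Inserting a vertex into a path\<close>

definition insertable :: "('a \<Rightarrow> 'a \<Rightarrow> bool) \<Rightarrow> 'a list \<Rightarrow> 'a \<Rightarrow> bool" where
  "insertable E p w \<longleftrightarrow>
     (\<exists>p1 p2. p = p1 @ p2 \<and> p1 \<noteq> [] \<and> p2 \<noteq> [] \<and> E (last p1) w \<and> E w (hd p2))"

lemma insertable_Cons: "insertable E p w \<Longrightarrow> insertable E (a # p) w"
  unfolding insertable_def by (metis append_Cons last_ConsR list.distinct(1))

lemma insertable_append: "insertable E p w \<Longrightarrow> insertable E (q @ p) w"
  by (induction q) (auto intro: insertable_Cons)

text \<open>The first vertex of \<open>p\<close> dominates \<open>w\<close> and some vertex of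
  \<open>p\<close> is dominated by \<open>w\<close>, so the direction changes between two
  consecutive vertices.\<close>

lemma insertableI:
  assumes "tourn V E" "set p \<subseteq> V" "w \<in> V - set p" "p \<noteq> []" "E (hd p) w" "u \<in> set p" "E w u"
  shows "insertable E p w"
  using assms(2-)
proof (induction p)
  case (Cons a p)
  have "u \<noteq> a" using Cons.prems tourn_asym[OF assms(1), of a w] by auto
  hence u: "u \<in> set p" using Cons.prems by auto
  hence pne: "p \<noteq> []" by auto
  show ?case
  proof (cases "E w (hd p)")
    case True
    thus ?thesis using Cons.prems pne unfolding insertable_def
      by (intro exI[of _ "[a]"] exI[of _ p]) auto
  next
    case False
    hence "E (hd p) w" using Cons.prems pne
      by (intro tourn_total[OF assms(1), of w "hd p"]) (auto dest: hd_in_set)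
    thus ?thesis using Cons u pne by (intro insertable_Cons) auto
  qed
qed simp

text \<open>If \<open>u\<close> dominated \<open>w\<close>, then \<open>insertableI\<close> would
  apply to the part of \<open>p\<close> from \<open>u\<close> on, whose last vertex is dominated by
  \<open>w\<close>.\<close>

lemma not_insertable_last:
  assumes "tourn V E" "set p \<subseteq> V" "w \<in> V - set p" "p \<noteq> []" "\<not> insertable E p w"
    and "\<not> E (last p) w" "u \<in> set p"
  shows "E w u"
proof (rule ccontr)
  assume "\<not> E w u"
  hence uw: "E u w" using assms by (intro tourn_total[OF assms(1), of w u]) auto
  obtain p1 p2 where p: "p = p1 @ u # p2" using assms by (meson split_list)
  have lst: "last p = last (u # p2)" using p by simp
  have "E w (last p)" using assms by (intro tourn_total[OF assms(1), of "last p" w]) (auto dest: last_in_set)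
  hence "insertable E (u # p2) w"
    using assms p uw lst last_in_set[of "u # p2"]
    by (intro insertableI[OF assms(1), of _ _ "last p"]) auto
  thus False using assms(5) p by (simp add: insertable_append)
qed

lemma not_insertable_hd:
  assumes "tourn V E" "set p \<subseteq> V" "w \<in> V - set p" "p \<noteq> []" "\<not> insertable E p w"
    and "\<not> E w (hd p)" "u \<in> set p"
  shows "E u w"
proof (rule ccontr)
  assume "\<not> E u w"
  hence uw: "E w u" using assms by (intro tourn_total[OF assms(1), of u w]) auto
  have "E (hd p) w" using assms by (intro tourn_total[OF assms(1), of w "hd p"]) (auto dest: hd_in_set)
  from insertableI[OF assms(1-4) this assms(7) uw] show False using assms(5) by simp
qed

lemma insertable_walk:
  assumes "insertable E p w" "walk V E A B p" "distinct p" "w \<in> V - set p"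
  shows "\<exists>q. walk V E A B q \<and> distinct q \<and> set q = insert w (set p)"
proof -
  obtain p1 p2 where "p = p1 @ p2" "p1 \<noteq> []" "p2 \<noteq> []" "E (last p1) w" "E w (hd p2)"
    using assms unfolding insertable_def by blast
  thus ?thesis using assms unfolding walk_def
    by (intro exI[of _ "p1 @ w # p2"]) (auto simp: successively_append_iff successively_Cons)
qed

lemma third_index:
  fixes i j :: nat
  assumes "i < 3" "j < 3" "i \<noteq> j"
  shows "\<exists>k. {i, j, k} = {..<3} \<and> k \<noteq> i \<and> k \<noteq> j"
proof (intro exI conjI)
  have "i \<in> {0, 1, 2}" "j \<in> {0, 1, 2}" using assms by auto
  thus "{i, j, 3 - i - j} = {..<3}" "3 - i - j \<noteq> i" "3 - i - j \<noteq> j"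
    using assms(3) by (auto simp: lessThan_Suc numeral_3_eq_3)
qed

text \<open>Take three disjoint paths with maximal union. A vertex \<open>w\<close> outside that cannot be inserted
  into a path dominates an initial segment of it and is dominated by the rest. Call \<open>w\<close> an entry if
  it is dominated by the end of a path and an exit if it dominates the start of one. A longest path
  \<open>\<alpha>\<close> from an entry to an exit contains all of the uncovered vertices, since otherwise
  strong connectivity yields two vertices by which it can be prolonged. It then links two
  of the paths, and merging with the third gives the Hamiltonian path.\<close>

theorem hamiltonian_path_from_three:
  fixes f0 :: "nat \<Rightarrow> 'a list"
  assumes T: "tourn V E" and st: "strong V E"
    and three: "\<forall>i<3. walk V E A B (f0 i) \<and> distinct (f0 i)"
      "\<forall>i<3. \<forall>j<3. i \<noteq> j \<longrightarrow> set (f0 i) \<inter> set (f0 j) = {}"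
  shows "\<exists>r. walk V E A B r \<and> distinct r \<and> set r = V"
proof -
  have fin: "finite V" using T by (simp add: tourn_def)
  define ok where "ok f \<longleftrightarrow> (\<forall>i<3::nat. walk V E A B (f i) \<and> distinct (f i))
      \<and> (\<forall>i<3. \<forall>j<3. i \<noteq> j \<longrightarrow> set (f i) \<inter> set (f j) = {})" for f
  define cov where "cov f = (\<Union>i<3::nat. set (f i))" for f :: "nat \<Rightarrow> 'a list"
  have covV: "cov f \<subseteq> V" if "ok f" for f using that unfolding ok_def cov_def walk_def by blast
  obtain f where f: "ok f" and max: "\<And>g. ok g \<Longrightarrow> card (cov g) \<le> card (cov f)"
  proof -
    have "card (cov g) < Suc (card V)" if "ok g" for g
      using card_mono[OF fin covV[OF that]] by simp
    moreover have "ok f0" using three by (simp add: ok_def)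
    ultimately show ?thesis
      using ex_has_greatest_nat[of ok f0 "\<lambda>f. card (cov f)" "Suc (card V)"] that by blast
  qed
  have fw: "walk V E A B (f i)" "distinct (f i)" "f i \<noteq> []" "set (f i) \<subseteq> V" if "i < 3" for i
    using f that unfolding ok_def walk_def by auto
  have fd: "set (f i) \<inter> set (f j) = {}" if "i < 3" "j < 3" "i \<noteq> j" for i j
    using f that unfolding ok_def by auto
  define C where "C = cov f"
  have CV: "C \<subseteq> V" using covV f by (simp add: C_def)
  have fC: "set (f i) \<subseteq> C" if "i < 3" for i using that by (auto simp: C_def cov_def)
  define W where "W = V - C"
  \<comment> \<open>An insertion would enlarge the union of the three paths.\<close>
  have rigid: "\<not> insertable E (f i) w" if wi: "w \<in> W" "i < 3" for w i
  proof
    assume "insertable E (f i) w"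
    moreover have "w \<in> V - set (f i)" using wi fC by (auto simp: W_def)
    ultimately obtain q where q: "walk V E A B q" "distinct q" "set q = insert w (set (f i))"
      using insertable_walk fw[OF wi(2)] by metis
    have w: "w \<notin> set (f j)" if "j < 3" for j using fC that \<open>w \<in> W\<close> by (auto simp: W_def)
    have "ok (f(i := q))" using f q w wi unfolding ok_def by auto
    moreover have "cov (f(i := q)) = insert w C" using q wi by (auto simp: cov_def C_def split: if_splits)
    moreover have "finite C" using CV fin finite_subset by blast
    ultimately show False using max[of "f(i := q)"] wi by (auto simp: W_def C_def)
  qed
  define In where "In w \<longleftrightarrow> (\<exists>i<3. E (last (f i)) w)" for w
  define Out where "Out w \<longleftrightarrow> (\<exists>i<3. E w (hd (f i)))" for w
  have WV: "w \<in> V - set (f i)" if "w \<in> W" "i < 3" for w i using that fC by (auto simp: W_def)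
  have dom: "E w u" if "w \<in> W" "i < 3" "\<not> E (last (f i)) w" "u \<in> set (f i)" for w i u
    using not_insertable_last[OF T fw(4)[OF that(2)] WV[OF that(1,2)] fw(3)[OF that(2)] rigid[OF that(1,2)]] that
    by blast
  have sub: "E u w" if "w \<in> W" "i < 3" "\<not> E w (hd (f i))" "u \<in> set (f i)" for w i u
    using not_insertable_hd[OF T fw(4)[OF that(2)] WV[OF that(1,2)] fw(3)[OF that(2)] rigid[OF that(1,2)]] that
    by blast
  have notIn: "E w u" if "w \<in> W" "\<not> In w" "u \<in> C" for w u
    using that dom unfolding In_def C_def cov_def by blast
  have notOut: "E u w" if "w \<in> W" "\<not> Out w" "u \<in> C" for w u
    using that sub unfolding Out_def C_def cov_def by blast
  have f0C: "hd (f 0) \<in> C" "last (f 0) \<in> C" using fC[of 0] fw(3)[of 0] by auto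
  \<comment> \<open>A vertex that is not an entry dominates every vertex of the three paths, in
    particular the start of one.\<close>
  have InOut: "In w \<or> Out w" if "w \<in> W" for w
    using dom[OF that, of 0 "hd (f 0)"] fw(3)[of 0] zero_less_numeral
    unfolding In_def Out_def by (metis hd_in_set)
  define good where "good a \<longleftrightarrow> distinct a \<and> set a \<subseteq> W \<and> successively E a
      \<and> (a \<noteq> [] \<longrightarrow> In (hd a) \<and> Out (last a))" for a
  have "good []" by (simp add: good_def)
  moreover have "length a < Suc (card W)" if "good a" for a
  proof -
    have "card (set a) \<le> card W" using that fin by (intro card_mono) (auto simp: good_def W_def)
    thus ?thesis using that distinct_card[of a] by (simp add: good_def)
  qed
  ultimately obtain \<alpha> where \<alpha>: "good \<alpha>" and longest: "\<And>a. good a \<Longrightarrow> length a \<le> length \<alpha>"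
    using ex_has_greatest_nat[of good "[]" length "Suc (card W)"] by blast
  have \<alpha>W: "set \<alpha> \<subseteq> W" "set \<alpha> \<subseteq> V" using \<alpha> by (auto simp: good_def W_def)
  \<comment> \<open>For nonempty \<open>\<alpha>\<close>, maximality forbids inserting, prepending
    or appending \<open>z\<close>. So all edges between \<open>z\<close> and \<open>\<alpha>\<close>
    have one direction, and \<open>z\<close> is no entry if it dominates \<open>\<alpha>\<close>, no
    exit if it is dominated.\<close>
  have outside: "(\<not> In z \<and> (\<forall>u\<in>set \<alpha>. E z u)) \<or> (\<not> Out z \<and> (\<forall>u\<in>set \<alpha>. E u z))"
    if z: "z \<in> W - set \<alpha>" for z
  proof (cases "\<alpha> = []")
    case True
    have "\<not> good [z]" using longest[of "[z]"] True by auto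
    thus ?thesis using z True by (auto simp: good_def)
  next
    case False
    have zV: "z \<in> V - set \<alpha>" using z by (auto simp: W_def)
    have ni: "\<not> insertable E \<alpha> z"
    proof
      assume "insertable E \<alpha> z"
      then obtain p1 p2 where "\<alpha> = p1 @ p2" "p1 \<noteq> []" "p2 \<noteq> []" "E (last p1) z" "E z (hd p2)"
        unfolding insertable_def by blast
      hence "good (p1 @ z # p2)" "length (p1 @ z # p2) > length \<alpha>"
        using \<alpha> z unfolding good_def by (auto simp: successively_append_iff successively_Cons)
      thus False using longest leD by blast
    qed
    have zin: "\<not> In z" if "E z (hd \<alpha>)"
    proof
      assume "In z"
      hence "good (z # \<alpha>)" using \<alpha> z that False unfolding good_def by (auto simp: successively_Cons)
      thus False using longest by force
    qed
    have zout: "\<not> Out z" if "E (last \<alpha>) z"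
    proof
      assume "Out z"
      hence "good (\<alpha> @ [z])" using \<alpha> z that False unfolding good_def by (auto simp: successively_append_iff)
      thus False using longest by force
    qed
    show ?thesis
    proof (cases "E z (hd \<alpha>)")
      case True
      hence "\<not> In z" by (rule zin)
      hence "\<not> E (last \<alpha>) z" using zout InOut z by blast
      hence "\<forall>u\<in>set \<alpha>. E z u" using not_insertable_last[OF T \<alpha>W(2) zV False ni] by blast
      thus ?thesis using \<open>\<not> In z\<close> by blast
    next
      case False
      hence "\<forall>u\<in>set \<alpha>. E u z" using not_insertable_hd[OF T \<alpha>W(2) zV \<open>\<alpha> \<noteq> []\<close> ni] by blast
      thus ?thesis using zout \<open>\<alpha> \<noteq> []\<close> by auto
    qed
  qed
  have \<alpha>all: "set \<alpha> = W"
  proof (rule ccontr)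
    assume "set \<alpha> \<noteq> W"
    then obtain z where z: "z \<in> W - set \<alpha>" using \<alpha>W by auto
    define Zi where "Zi = {z \<in> W - set \<alpha>. \<not> In z \<and> (\<forall>u\<in>set \<alpha>. E z u)}"
    define Zo where "Zo = {z \<in> W - set \<alpha>. \<not> Out z \<and> (\<forall>u\<in>set \<alpha>. E u z)}"
    have Z: "W - set \<alpha> \<subseteq> Zi \<union> Zo" using outside by (auto simp: Zi_def Zo_def)
    have Ci: "E w u" if "w \<in> Zi" "u \<in> C \<union> set \<alpha>" for w u using that notIn by (auto simp: Zi_def)
    have Co: "E u w" if "w \<in> Zo" "u \<in> C \<union> set \<alpha>" for w u using that notOut by (auto simp: Zo_def)
    have sV: "Zi \<subseteq> V" "Zo \<subseteq> V" "C \<union> set \<alpha> \<subseteq> V" using CV \<alpha>W by (auto simp: Zi_def Zo_def W_def)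
    have V: "V = C \<union> set \<alpha> \<union> Zi \<union> Zo" using Z sV by (auto simp: W_def)
    have disj: "hd (f 0) \<notin> Zi" "hd (f 0) \<notin> Zo" using f0C by (auto simp: Zi_def Zo_def W_def)
    \<comment> \<open>Strong connectivity gives an edge into \<open>Zi\<close>, or an edge out of
      \<open>Zo\<close> if \<open>Zi\<close> is empty. Since \<open>Zi\<close> dominates
      \<open>C \<union> set \<alpha>\<close> and \<open>Zo\<close> is dominated by it, such an edge
      can only run from \<open>Zo\<close> to \<open>Zi\<close>.\<close>
    have "\<exists>s\<in>Zo. \<exists>d\<in>Zi. E s d"
    proof (cases "Zi = {}")
      case False
      have "V - Zi \<noteq> {}" "V - Zi \<noteq> V" using disj f0C CV False sV by auto
      then obtain u v where uv: "u \<in> V - Zi" "v \<in> V - (V - Zi)" "E u v"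
        using st unfolding strong_def by (meson Diff_subset)
      hence "v \<in> Zi" by auto
      moreover have "u \<notin> C \<union> set \<alpha>"
        using Ci[OF \<open>v \<in> Zi\<close>] uv tourn_asym[OF T, of u v] by auto
      ultimately show ?thesis using uv V by auto
    next
      case True
      hence "Zo \<noteq> {}" using z Z by auto
      moreover have "Zo \<noteq> V" using disj f0C CV by auto
      ultimately obtain u v where uv: "u \<in> Zo" "v \<in> V - Zo" "E u v"
        using st sV unfolding strong_def by meson
      have "v \<notin> C \<union> set \<alpha>"
        using Co[OF \<open>u \<in> Zo\<close>] uv sV tourn_asym[OF T, of u v] by auto
      thus ?thesis using uv V by auto
    qed
    then obtain s d where sd: "s \<in> Zo" "d \<in> Zi" "E s d" by blast
    have W: "s \<in> W" "d \<in> W" "s \<notin> set \<alpha>" "d \<notin> set \<alpha>" "s \<noteq> d" "\<not> Out s" "\<not> In d"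
      using sd T sV by (auto simp: Zi_def Zo_def tourn_def)
    hence "In s" "Out d" using InOut by auto
    \<comment> \<open>\<open>s\<close> is dominated by the end of \<open>\<alpha>\<close>, and
      \<open>d\<close> is an exit. If \<open>\<alpha>\<close> is empty, it matters that
      \<open>s\<close> is an entry.\<close>
    hence "good (\<alpha> @ [s, d])"
      using \<alpha> W sd Co[OF sd(1)] unfolding good_def
      by (cases "\<alpha> = []") (auto simp: successively_append_iff successively_Cons)
    thus False using longest by force
  qed
  have pair: "\<exists>r. walk V E A B r \<and> distinct r \<and> set r = V"
    if "walk V E A B s" "distinct s" "set s \<inter> set (f k) = {}" "set s \<union> set (f k) = V" "k < 3" for s k
    using merge_walks[OF T that(3,1,2) fw(1,2)[OF that(5)]] that(4) by simp
  have C3: "C = set (f i) \<union> set (f j) \<union> set (f k)" if "{i, j, k} = {..<3}" for i j k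
    unfolding C_def cov_def that[symmetric] by auto
  have \<alpha>C: "set \<alpha> \<inter> set (f i) = {}" if "i < 3" for i using \<alpha>all fC[OF that] by (auto simp: W_def)
  have VC: "V = C \<union> set \<alpha>" using \<alpha>all CV by (auto simp: W_def)
  show ?thesis
  proof (cases "\<alpha> = []")
    case True
    obtain s where s: "walk V E A B s" "distinct s" "set s = set (f 0) \<union> set (f 1)"
      using merge_walks[OF T fd[of 0 1] fw(1,2)[of 0] fw(1,2)[of 1]] by auto
    have "{0, 1, 2} = {..<3::nat}" by auto
    from C3[OF this] show ?thesis
      using s VC True fd[of 0 2] fd[of 1 2] by (intro pair[of s 2]) auto
  next
    case False
    have \<alpha>': "distinct \<alpha>" "successively E \<alpha>" "In (hd \<alpha>)" "Out (last \<alpha>)"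
      using \<alpha> False by (auto simp: good_def)
    then obtain i j where ij: "i < 3" "E (last (f i)) (hd \<alpha>)" "j < 3" "E (last \<alpha>) (hd (f j))"
      by (auto simp: In_def Out_def)
    have joined: ?thesis if ij: "i < 3" "E (last (f i)) (hd \<alpha>)" "j < 3" "E (last \<alpha>) (hd (f j))" "i \<noteq> j" for i j
    proof -
      have "\<exists>k. {i, j, k} = {..<3} \<and> k \<noteq> i \<and> k \<noteq> j"
        by (rule third_index[OF ij(1,3,5)])
      then obtain k where k: "{i, j, k} = {..<3}" "k \<noteq> i" "k \<noteq> j" by blast
      hence k3: "k < 3" by auto
      have "walk V E A B (f i @ \<alpha> @ f j)"
        using fw[OF ij(1)] fw[OF ij(3)] \<alpha>' \<alpha>W ij False unfolding walk_def
        by (auto simp: successively_append_iff)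
      moreover have "distinct (f i @ \<alpha> @ f j)"
        using fw(2)[OF ij(1)] fw(2)[OF ij(3)] \<alpha>' fd[OF ij(1,3,5)] \<alpha>C[OF ij(1)] \<alpha>C[OF ij(3)] by auto
      moreover have "set (f i @ \<alpha> @ f j) \<inter> set (f k) = {}"
        using fd[OF ij(1) k3] fd[OF ij(3) k3] k \<alpha>C[OF k3] by auto
      moreover have "set (f i @ \<alpha> @ f j) \<union> set (f k) = V" using VC C3[OF k(1)] by auto
      ultimately show ?thesis using pair k3 by blast
    qed
    show ?thesis
    proof (cases "\<exists>i<3. \<exists>j<3. i \<noteq> j \<and> E (last (f i)) (hd \<alpha>) \<and> E (last \<alpha>) (hd (f j))")
      case True thus ?thesis using joined by blast
    next
      case no: False
      have jj: "i = j" using no ij by blast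
      have "\<exists>a. a < 3 \<and> i \<noteq> a" by (intro exI[of _ "if i = 0 then 1 else 0"]) auto
      then obtain a where "a < 3" "i \<noteq> a" by blast
      with third_index[OF ij(1) this]
      have "\<exists>a b. {i, a, b} = {..<3} \<and> i \<noteq> a \<and> i \<noteq> b \<and> a \<noteq> b" by metis
      then obtain a b where ab: "{i, a, b} = {..<3}" "i \<noteq> a" "i \<noteq> b" "a \<noteq> b" by blast
      hence ab3: "a < 3" "b < 3" by auto
      have hdW: "hd \<alpha> \<in> W" "last \<alpha> \<in> W" using False \<alpha>W by auto
      \<comment> \<open>Now the same \<open>f i\<close> leads into \<open>\<alpha>\<close> and is
        reached from it. So \<open>\<alpha>\<close> can be cut at \<open>t\<close> and its parts
        exchanged around \<open>f i\<close>, which joins all three paths into one.\<close>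
      have split: ?thesis if t: "0 < t" "t < length \<alpha>" "E (last (f a)) (\<alpha> ! t)" "E (\<alpha> ! (t - 1)) (hd (f b))"
        and ab: "{i, a, b} = {..<3}" "i \<noteq> a" "i \<noteq> b" "a \<noteq> b" for t a b
      proof -
        have ab3: "a < 3" "b < 3" using ab by auto
        define s where "s = f a @ drop t \<alpha> @ f i @ take t \<alpha> @ f b"
        have "successively E (drop t \<alpha>)" "successively E (take t \<alpha>)"
          using \<alpha>'(2) by (metis append_take_drop_id successively_append_iff)+
        moreover have "hd (drop t \<alpha>) = \<alpha> ! t" "last (drop t \<alpha>) = last \<alpha>" "drop t \<alpha> \<noteq> []"
          "hd (take t \<alpha>) = hd \<alpha>" "take t \<alpha> \<noteq> []" "last (take t \<alpha>) = \<alpha> ! (t - 1)"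
          using t False by (simp_all add: hd_drop_conv_nth last_conv_nth[of "take t \<alpha>"] min_def)
        moreover have "E (last \<alpha>) (hd (f i))" using ij jj by simp
        ultimately have "successively E s"
          using fw[OF ij(1)] fw[OF ab3(1)] fw[OF ab3(2)] ij t
          unfolding s_def walk_def by (auto simp: successively_append_iff)
        moreover have "set s = V"
        proof -
          have "set \<alpha> = set (take t \<alpha>) \<union> set (drop t \<alpha>)" by (metis append_take_drop_id set_append)
          thus ?thesis using VC C3[OF ab(1)] by (auto simp: s_def)
        qed
        moreover have "distinct s"
        proof -
          have "distinct (take t \<alpha> @ drop t \<alpha>)" using \<alpha>' by simp
          hence "set (take t \<alpha>) \<inter> set (drop t \<alpha>) = {}" "distinct (take t \<alpha>)" "distinct (drop t \<alpha>)"
            unfolding distinct_append by blast+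
          moreover have "set (take t \<alpha>) \<subseteq> set \<alpha>" "set (drop t \<alpha>) \<subseteq> set \<alpha>"
            by (auto dest: in_set_takeD in_set_dropD)
          moreover have "set (f i) \<inter> set (f a) = {}" "set (f i) \<inter> set (f b) = {}" "set (f a) \<inter> set (f b) = {}"
            using fd ij(1) ab3 ab by blast+
          ultimately show ?thesis
            using fw(2)[OF ij(1)] fw(2)[OF ab3(1)] fw(2)[OF ab3(2)] \<alpha>C[OF ij(1)] \<alpha>C[OF ab3(1)] \<alpha>C[OF ab3(2)]
            unfolding s_def distinct_append set_append by blast
        qed
        moreover have "hd s \<in> A" "last s \<in> B" "s \<noteq> []"
          using fw[OF ab3(1)] fw[OF ab3(2)] unfolding s_def walk_def by auto
        ultimately show ?thesis unfolding walk_def by blast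
      qed
      \<comment> \<open>Otherwise \<open>\<alpha>\<close> would link \<open>f c\<close> to
        \<open>f i\<close>, two different paths.\<close>
      have hd_dom: "E (hd \<alpha>) u" if "c < 3" "c \<noteq> i" "u \<in> set (f c)" for c u
        using dom[OF hdW(1) that(1) _ that(3)] no ij jj that by metis
      have last_sub: "E u (last \<alpha>)" if "c < 3" "c \<noteq> i" "u \<in> set (f c)" for c u
        using sub[OF hdW(2) that(1) _ that(3)] no ij jj that by metis
      define n where "n = length \<alpha>"
      have hdn: "hd \<alpha> = \<alpha> ! 0" and lastn: "last \<alpha> = \<alpha> ! (n - 1)" and n0: "0 < n"
        using False by (auto simp: n_def hd_conv_nth last_conv_nth)
      \<comment> \<open>The cut is made right after the last position \<open>s\<close> of
        \<open>\<alpha>\<close> that dominates \<open>hd (f a)\<close> if the end of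
        \<open>f b\<close> dominates the next vertex. Otherwise that next vertex dominates all of
        \<open>f b\<close>, the one after it is dominated by all of \<open>f a\<close>, and the cut
        goes between these two.\<close>
      define J where "J = {s. s < n \<and> E (\<alpha> ! s) (hd (f a))}"
      have "0 \<in> J" using hd_dom[OF ab3(1), of "hd (f a)"] ab fw(3)[OF ab3(1)] n0 hdn by (auto simp: J_def)
      moreover have fJ: "finite J" by (simp add: J_def)
      ultimately have MJ: "Max J \<in> J" and le: "\<And>s. s \<in> J \<Longrightarrow> s \<le> Max J"
        by (auto intro: Max_in)
      define s where "s = Max J"
      have s: "s < n" "E (\<alpha> ! s) (hd (f a))" using MJ by (auto simp: J_def s_def)
      have after: "\<not> E (\<alpha> ! t) (hd (f a))" if "s < t" "t < n" for t
        using le[of t] that unfolding s_def by (metis J_def leD mem_Collect_eq)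
      have nW: "\<alpha> ! t \<in> W" if "t < n" for t using that \<alpha>W by (auto simp: n_def)
      have "s \<noteq> n - 1"
      proof
        assume "s = n - 1"
        hence "E (last \<alpha>) (hd (f a))" using s lastn by simp
        thus False using no ij ab3 ab by blast
      qed
      hence s1: "Suc s < n" using s by linarith
      show ?thesis
      proof (cases "E (last (f b)) (\<alpha> ! Suc s)")
        case True
        show ?thesis
          by (rule split[of "Suc s" b a]) (use True s s1 ab in \<open>auto simp: n_def\<close>)
      next
        case nb: False
        have Esb: "E (\<alpha> ! Suc s) (hd (f b))"
          using dom[OF nW[OF s1] ab3(2) nb] fw(3)[OF ab3(2)] by simp
        have "Suc s \<noteq> n - 1"
        proof
          assume "Suc s = n - 1"
          hence "E (last (f b)) (\<alpha> ! Suc s)"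
            using last_sub[OF ab3(2), of "last (f b)"] ab fw(3)[OF ab3(2)] lastn by simp
          thus False using nb by simp
        qed
        hence s2: "Suc (Suc s) < n" using s1 by linarith
        have "E (last (f a)) (\<alpha> ! Suc (Suc s))"
          using sub[OF nW[OF s2] ab3(1) after[OF _ s2]] fw(3)[OF ab3(1)] by simp
        thus ?thesis
          by (intro split[of "Suc (Suc s)" a b]) (use Esb s2 ab in \<open>auto simp: n_def\<close>)
      qed
    qed
  qed
qed

section \<open>Reserving vertices\<close>

text \<open>The connection from \<open>A\<close> to \<open>B\<close> is a hypothesis of its own
  rather than derived from \<open>kconn 3\<close>: for one pair of terminals, the tournament without
  them is only known to satisfy \<open>kconn 2\<close>.\<close>

lemma hamiltonian_path:
  assumes T: "tourn V E" and st: "strong V E" and AB: "A \<subseteq> V" "B \<subseteq> V"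
    and "\<And>S. S \<subseteq> V \<Longrightarrow> card S < 3 \<Longrightarrow> \<exists>p. walk (V - S) E A B p"
  shows "\<exists>r. walk V E A B r \<and> distinct r \<and> set r = V"
proof -
  have "finite V" using T by (simp add: tourn_def)
  then obtain P Q R where PQR: "\<forall>p\<in>{P, Q, R}. walk V E A B p \<and> distinct p"
    "set P \<inter> set Q = {}" "set P \<inter> set R = {}" "set Q \<inter> set R = {}"
    using three_disjoint_paths[of V A B E] assms by blast
  define f where "f i = (if i = 0 then P else if i = 1 then Q else R)" for i :: nat
  have "\<forall>i<3. walk V E A B (f i) \<and> distinct (f i)" using PQR by (auto simp: f_def)
  moreover have "\<forall>i<3. \<forall>j<3. i \<noteq> j \<longrightarrow> set (f i) \<inter> set (f j) = {}"
    using PQR by (auto simp: f_def)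
  ultimately show ?thesis using hamiltonian_path_from_three[OF T st] by blast
qed

lemma hamiltonian_path_kconn:
  assumes T: "tourn V E" and k: "kconn 3 V E" and AB: "A \<subseteq> V" "B \<subseteq> V" "3 \<le> card A" "3 \<le> card B"
  shows "\<exists>r. walk V E A B r \<and> distinct r \<and> set r = V"
proof (rule hamiltonian_path[OF T _ AB(1,2)])
  show "strong V E" using k by (rule kconn_strong) simp
  fix S assume S: "S \<subseteq> V" "card S < 3"
  have "finite S" using S T finite_subset by (auto simp: tourn_def)
  hence "\<not> A \<subseteq> S" "\<not> B \<subseteq> S" using AB S card_mono[of S A] card_mono[of S B] by auto
  then obtain a b where "a \<in> A \<inter> (V - S)" "b \<in> B \<inter> (V - S)" using AB by blast
  moreover have "strong (V - S) E" using k S by (simp add: kconn_def)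
  ultimately show "\<exists>p. walk (V - S) E A B p" using strong_walk by meson
qed

section \<open>Levels of a shortest path\<close>

text \<open>An edge from \<open>u\<close> on level 0 to \<open>v\<close> would skip a level, so the
  edge is directed the other way.\<close>

lemma layered_dominates_start:
  assumes "layered U E A B p h" "tourn U E" "v \<in> set p" "2 \<le> h v" "u \<in> A \<inter> U"
  shows "E v u"
proof -
  have v: "v \<in> U" using assms by (auto simp: layered_def walk_def)
  have u0: "h u = 0" using assms(1,5) unfolding layered_def by blast
  have "\<not> E u v"
  proof
    assume "E u v"
    hence "h v \<le> Suc (h u)" using assms(1,5) v unfolding layered_def by blast
    thus False using u0 assms by simp
  qed
  moreover have "u \<noteq> v" using u0 assms(4) by auto
  ultimately show ?thesis using assms v by (intro tourn_total[of U E u v]) auto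
qed

lemma layered_dominated_by_end:
  assumes "layered U E A B p h" "tourn U E" "v \<in> set p" "h v + 2 < length p" "u \<in> B \<inter> U"
  shows "E u v"
proof -
  have v: "v \<in> U" using assms by (auto simp: layered_def walk_def)
  have ul: "length p \<le> Suc (h u)" using assms(1,5) unfolding layered_def by blast
  have "\<not> E v u"
  proof
    assume "E v u"
    hence "h u \<le> Suc (h v)" using assms(1,5) v unfolding layered_def by blast
    thus False using ul assms by simp
  qed
  moreover have "u \<noteq> v" using ul assms(4) by auto
  ultimately show ?thesis using assms v by (intro tourn_total[of U E v u]) auto
qed

lemma layered_inj: "layered U E A B p h \<Longrightarrow> inj_on h (set p)"
  unfolding layered_def by (metis in_set_conv_nth inj_onI)

text \<open>The path has only one vertex on each level.\<close>

lemma layered_level_card: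
  assumes "layered U E A B p h" "S \<subseteq> set p" "h ` S \<subseteq> L" "finite L"
  shows "card S \<le> card L"
  by (rule card_inj_on_le[OF inj_on_subset[OF layered_inj[OF assms(1)] assms(2)] assms(3,4)])

lemma layered_start_card:
  assumes "layered U E A B p h"
  shows "card (A \<inter> set p) \<le> 1"
proof -
  have "h ` (A \<inter> set p) \<subseteq> {0}" using assms by (auto simp: layered_def walk_def)
  from layered_level_card[OF assms _ this] show ?thesis by simp
qed

lemma layered_end_card:
  assumes "layered U E A B p h"
  shows "card (B \<inter> set p) \<le> 1"
proof -
  have "h ` (B \<inter> set p) \<subseteq> {length p - 1}"
  proof
    fix x assume "x \<in> h ` (B \<inter> set p)"
    then obtain v where v: "x = h v" "v \<in> B \<inter> U" using assms by (auto simp: layered_def walk_def)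
    hence "length p \<le> Suc x" "x < length p" using assms by (auto simp: layered_def)
    thus "x \<in> {length p - 1}" by auto
  qed
  from layered_level_card[OF assms _ this] show ?thesis by simp
qed

lemma layered_late_card:
  assumes "layered U E A B p h"
  shows "card (C \<inter> set p) \<le> card {v \<in> C \<inter> set p. 2 \<le> h v} + 2"
proof -
  let ?L = "{v \<in> C \<inter> set p. h v < 2}"
  have "h ` ?L \<subseteq> {0, 1}" by auto
  from layered_level_card[OF assms _ this] have "card ?L \<le> card {0, 1::nat}" by blast
  moreover have "C \<inter> set p = {v \<in> C \<inter> set p. 2 \<le> h v} \<union> ?L" by auto
  hence "card (C \<inter> set p) \<le> card {v \<in> C \<inter> set p. 2 \<le> h v} + card ?L"
    by (metis (no_types, lifting) card_Un_le)
  ultimately show ?thesis by simp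
qed

lemma layered_early_card:
  assumes "layered U E A B p h"
  shows "card (C \<inter> set p) \<le> card {v \<in> C \<inter> set p. h v + 2 < length p} + 2"
proof -
  let ?L = "{v \<in> C \<inter> set p. length p \<le> h v + 2}"
  have "h ` ?L \<subseteq> {length p - 2, length p - 1}"
  proof
    fix x assume "x \<in> h ` ?L"
    hence "length p \<le> x + 2" "x < length p" using assms by (auto simp: layered_def)
    thus "x \<in> {length p - 2, length p - 1}" by auto
  qed
  from layered_level_card[OF assms _ this] have "card ?L \<le> card {length p - 2, length p - 1}" by blast
  also have "\<dots> \<le> 2" by (simp add: card_insert_if)
  finally have "card ?L \<le> 2" .
  moreover have "C \<inter> set p = {v \<in> C \<inter> set p. h v + 2 < length p} \<union> ?L" by auto
  hence "card (C \<inter> set p) \<le> card {v \<in> C \<inter> set p. h v + 2 < length p} + card ?L"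
    by (metis (no_types, lifting) card_Un_le)
  ultimately show ?thesis by linarith
qed

section \<open>Swallowed sets and the choice of the next path\<close>

text \<open>Quantifying over all small \<open>R\<close> makes the relation independent of which
  vertices get reserved, so that the index \<open>l\<close> can be chosen beforehand. Of
  \<open>m + 2\<close> swallowed vertices, \<open>m\<close> remain after discarding two levels, more
  than another set of fewer than \<open>m\<close> vertices can contain.\<close>

definition swallows ::
    "nat \<Rightarrow> 'a set \<Rightarrow> ('a \<Rightarrow> 'a \<Rightarrow> bool) \<Rightarrow> 'a set \<Rightarrow> 'a set \<Rightarrow> 'a set \<Rightarrow> bool" where
  "swallows m V E A B C \<longleftrightarrow> (\<exists>R p h. R \<subseteq> V \<and> card R < m \<and> layered (V - R) E A B p h
     \<and> m + 2 \<le> card (C \<inter> set p))"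

text \<open>Some \<open>v\<close> in \<open>A'\<close> lies on \<open>p\<close> at level 2 or higher
  and outside \<open>R'\<close>, and some \<open>u\<close> in \<open>A\<close> likewise on
  \<open>p'\<close> outside \<open>R\<close>. Each would dominate the other.\<close>

lemma swallows_start_antisym:
  assumes T: "tourn V E" and s: "swallows m V E A B A'" "swallows m V E A' B' A"
  shows False
proof -
  have fin: "finite V" using T by (simp add: tourn_def)
  obtain R p h where R: "R \<subseteq> V" "card R < m" "layered (V - R) E A B p h" "m + 2 \<le> card (A' \<inter> set p)"
    using s(1) by (auto simp: swallows_def)
  obtain R' p' h' where R': "R' \<subseteq> V" "card R' < m" "layered (V - R') E A' B' p' h'" "m + 2 \<le> card (A \<inter> set p')"
    using s(2) by (auto simp: swallows_def)
  let ?S = "{v \<in> A' \<inter> set p. 2 \<le> h v}" and ?S' = "{v \<in> A \<inter> set p'. 2 \<le> h' v}"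
  have "m \<le> card ?S" "m \<le> card ?S'"
    using layered_late_card[OF R(3), of A'] layered_late_card[OF R'(3), of A] R R' by linarith+
  moreover have "finite R" "finite R'" using R R' fin finite_subset by auto
  ultimately have "\<not> ?S \<subseteq> R'" "\<not> ?S' \<subseteq> R"
    using card_mono[of R' ?S] card_mono[of R ?S'] R R' by linarith+
  then obtain v u where vu: "v \<in> ?S" "v \<notin> R'" "u \<in> ?S'" "u \<notin> R" by blast
  have V: "v \<in> V" "u \<in> V" using vu R(3) R'(3) by (auto simp: layered_def walk_def)
  have "E v u"
    using layered_dominates_start[OF R(3) tourn_subset[OF T]] vu V by auto
  moreover have "E u v"
    using layered_dominates_start[OF R'(3) tourn_subset[OF T]] vu V by auto
  ultimately show False using tourn_asym[OF T] V by blast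
qed

lemma swallows_end_antisym:
  assumes T: "tourn V E" and s: "swallows m V E A B B'" "swallows m V E A' B' B"
  shows False
proof -
  have fin: "finite V" using T by (simp add: tourn_def)
  obtain R p h where R: "R \<subseteq> V" "card R < m" "layered (V - R) E A B p h" "m + 2 \<le> card (B' \<inter> set p)"
    using s(1) by (auto simp: swallows_def)
  obtain R' p' h' where R': "R' \<subseteq> V" "card R' < m" "layered (V - R') E A' B' p' h'" "m + 2 \<le> card (B \<inter> set p')"
    using s(2) by (auto simp: swallows_def)
  let ?S = "{v \<in> B' \<inter> set p. h v + 2 < length p}" and ?S' = "{v \<in> B \<inter> set p'. h' v + 2 < length p'}"
  have "m \<le> card ?S" "m \<le> card ?S'"
    using layered_early_card[OF R(3), of B'] layered_early_card[OF R'(3), of B] R R' by linarith+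
  moreover have "finite R" "finite R'" using R R' fin finite_subset by auto
  ultimately have "\<not> ?S \<subseteq> R'" "\<not> ?S' \<subseteq> R"
    using card_mono[of R' ?S] card_mono[of R ?S'] R R' by linarith+
  then obtain v u where vu: "v \<in> ?S" "v \<notin> R'" "u \<in> ?S'" "u \<notin> R" by blast
  have V: "v \<in> V" "u \<in> V" using vu R(3) R'(3) by (auto simp: layered_def walk_def)
  have "E u v"
    using layered_dominated_by_end[OF R(3) tourn_subset[OF T]] vu V by auto
  moreover have "E v u"
    using layered_dominated_by_end[OF R'(3) tourn_subset[OF T]] vu V by auto
  ultimately show False using tourn_asym[OF T] V by blast
qed

text \<open>The relation off the diagonal, its converse and the diagonal are disjoint parts of
  \<open>I \<times> I\<close>.\<close>

lemma antisym_card: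
  assumes "finite I" and anti: "\<And>i j. i \<in> I \<Longrightarrow> j \<in> I \<Longrightarrow> i \<noteq> j \<Longrightarrow> \<not> (s i j \<and> s j i)"
  shows "2 * (\<Sum>l\<in>I. card {j \<in> I. j \<noteq> l \<and> s l j}) + card I \<le> card I * card I"
proof -
  let ?S = "SIGMA l:I. {j \<in> I. j \<noteq> l \<and> s l j}"
  let ?D = "(\<lambda>i. (i, i)) ` I"
  have "(\<Sum>l\<in>I. card {j \<in> I. j \<noteq> l \<and> s l j}) = card ?S"
    using assms by (intro card_SigmaI[symmetric]) auto
  moreover have fS: "finite ?S" using assms by auto
  have "card (?S\<inverse>) = card ?S" by simp
  moreover have "card (?S \<union> ?S\<inverse> \<union> ?D) = card ?S + card (?S\<inverse>) + card ?D"
  proof -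
    have "?S \<inter> ?S\<inverse> = {}" "(?S \<union> ?S\<inverse>) \<inter> ?D = {}" using anti by blast+
    thus ?thesis using fS assms(1) by (simp add: card_Un_disjoint)
  qed
  moreover have "card ?D = card I" by (intro card_image) (auto simp: inj_on_def)
  moreover have "card (?S \<union> ?S\<inverse> \<union> ?D) \<le> card (I \<times> I)" using assms by (intro card_mono) auto
  ultimately show ?thesis by (simp add: card_cartesian_product)
qed

text \<open>Summed over \<open>l\<close>, the two counts give at most
  \<open>card I * (card I - 1)\<close>.\<close>

lemma averaging:
  assumes I: "finite I" "I \<noteq> {}"
    and s: "\<And>i j. i \<in> I \<Longrightarrow> j \<in> I \<Longrightarrow> i \<noteq> j \<Longrightarrow> \<not> (s i j \<and> s j i)"
    and t: "\<And>i j. i \<in> I \<Longrightarrow> j \<in> I \<Longrightarrow> i \<noteq> j \<Longrightarrow> \<not> (t i j \<and> t j i)"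
  shows "\<exists>l\<in>I. card {j \<in> I. j \<noteq> l \<and> s l j} + card {j \<in> I. j \<noteq> l \<and> t l j} < card I"
proof (rule ccontr)
  assume "\<not> ?thesis"
  hence "(\<Sum>l\<in>I. card I) \<le> (\<Sum>l\<in>I. card {j \<in> I. j \<noteq> l \<and> s l j} + card {j \<in> I. j \<noteq> l \<and> t l j})"
    by (intro sum_mono) (simp add: not_less)
  moreover have "0 < card I" using I by (simp add: card_gt_0_iff)
  ultimately show False
    using antisym_card[of I s, OF I(1) s] antisym_card[of I t, OF I(1) t] by (simp add: sum.distrib)
qed

text \<open>\<open>(True, j)\<close> stands for the set \<open>A j\<close> of possible starts of the \<open>j\<close>-th path, \<open>(False, j)\<close>
  for the set \<open>B j\<close> of possible ends.\<close>

definition demand :: "('i \<Rightarrow> 'a set) \<Rightarrow> ('i \<Rightarrow> 'a set) \<Rightarrow> bool \<times> 'i \<Rightarrow> 'a set" where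
  "demand A B d = (if fst d then A (snd d) else B (snd d))"

text \<open>Vertices \<open>r d\<close> are reserved for as many swallowed sets as possible. If a
  shortest path in the rest still took \<open>m + 2\<close> vertices of an unserved set, one of them
  could be reserved for it too.\<close>

lemma reserve:
  assumes T: "tourn V E" and m: "0 < m"
    and l: "A l \<subseteq> V" "B l \<subseteq> V" "m \<le> card (A l)" "m \<le> card (B l)"
    and st: "\<And>R. R \<subseteq> V \<Longrightarrow> card R < m \<Longrightarrow> strong (V - R) E"
    and D: "finite D" "card {d \<in> D. swallows m V E (A l) (B l) (demand A B d)} < m"
  shows "\<exists>D' r p h. D' \<subseteq> D \<and> card D' < m \<and> inj_on r D' \<and> r ` D' \<subseteq> V
    \<and> (\<forall>d\<in>D'. r d \<in> demand A B d)
    \<and> (\<forall>d\<in>D'. \<forall>u\<in>demand A B (fst d, l) - r ` D'. if fst d then E (r d) u else E u (r d))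
    \<and> layered (V - r ` D') E (A l) (B l) p h
    \<and> (\<forall>d\<in>D - D'. card (demand A B d \<inter> set p) \<le> m + 1)"
proof -
  have fin: "finite V" using T by (simp add: tourn_def)
  let ?D0 = "{d \<in> D. swallows m V E (A l) (B l) (demand A B d)}"
  \<comment> \<open>Only sets in \<open>?D0\<close> are served, which keeps the number of reserved
    vertices below \<open>m\<close>. Domination is required only outside the reserved set, hence it
    survives further reservations.\<close>
  define ok where "ok = (\<lambda>(D', r). D' \<subseteq> ?D0 \<and> inj_on r D' \<and> r ` D' \<subseteq> V
    \<and> (\<forall>d\<in>D'. r d \<in> demand A B d)
    \<and> (\<forall>d\<in>D'. \<forall>u\<in>demand A B (fst d, l) - r ` D'. if fst d then E (r d) u else E u (r d)))"
  have small: "card D' < m" if "ok (D', r)" for D' and r :: "bool \<times> 'b \<Rightarrow> 'a"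
  proof -
    have "card D' \<le> card ?D0" using that D by (intro card_mono) (auto simp: ok_def)
    thus ?thesis using D by simp
  qed
  have "ok ({}, \<lambda>_. undefined)" by (simp add: ok_def)
  moreover have "\<forall>z. ok z \<longrightarrow> card (fst z) < m" using small by auto
  ultimately obtain z where z: "ok z" "\<forall>z'. ok z' \<longrightarrow> card (fst z') \<le> card (fst z)"
    using ex_has_greatest_nat[of ok "({}, \<lambda>_. undefined)" "\<lambda>z. card (fst z)" m] by blast
  obtain D' r where zDr: "z = (D', r)" by (cases z)
  have Dr: "ok (D', r)" using z zDr by simp
  have max: "card D'' \<le> card D'" if "ok (D'', r')" for D'' r'
    using z(2) that zDr by fastforce
  define R where "R = r ` D'"
  have fD': "finite D'" using Dr D finite_subset by (fastforce simp: ok_def)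
  have R: "R \<subseteq> V" "card R < m"
    using Dr small[OF Dr] card_image_le[OF fD', of r] by (auto simp: ok_def R_def)
  have fR: "finite R" using fD' by (simp add: R_def)
  have "\<not> A l \<subseteq> R" "\<not> B l \<subseteq> R" using card_mono[OF fR] R l by (metis leD le_trans order_le_less_trans)+
  then obtain a b where "a \<in> A l \<inter> (V - R)" "b \<in> B l \<inter> (V - R)" using l by blast
  then obtain p h where p: "layered (V - R) E (A l) (B l) p h"
    using strong_walk[OF st[OF R]] ex_layered by meson
  have "card (demand A B d \<inter> set p) \<le> m + 1" if d: "d \<in> D - D'" for d
  proof (rule ccontr)
    assume "\<not> ?thesis"
    hence c: "m + 2 \<le> card (demand A B d \<inter> set p)" by simp
    hence d0: "d \<in> ?D0" using d p R by (auto simp: swallows_def)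
    \<comment> \<open>Such a \<open>v\<close> is found among the swallowed vertices two levels away
      from the start, or from the end, of \<open>p\<close>.\<close>
    have "\<exists>v\<in>demand A B d \<inter> set p. \<forall>u\<in>demand A B (fst d, l) \<inter> (V - R). if fst d then E v u else E u v"
    proof (cases "fst d")
      case True
      have "card {v \<in> demand A B d \<inter> set p. 2 \<le> h v} \<noteq> 0"
        using layered_late_card[OF p, of "demand A B d"] c m by linarith
      hence "{v \<in> demand A B d \<inter> set p. 2 \<le> h v} \<noteq> {}" by (metis card.empty)
      then obtain v where v: "v \<in> demand A B d \<inter> set p" "2 \<le> h v" by blast
      have "E v u" if "u \<in> A l \<inter> (V - R)" for u
        using layered_dominates_start[OF p tourn_subset[OF T] _ v(2) that] v by auto
      thus ?thesis using v True by (auto simp: demand_def)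
    next
      case False
      have "card {v \<in> demand A B d \<inter> set p. h v + 2 < length p} \<noteq> 0"
        using layered_early_card[OF p, of "demand A B d"] c m by linarith
      hence "{v \<in> demand A B d \<inter> set p. h v + 2 < length p} \<noteq> {}" by (metis card.empty)
      then obtain v where v: "v \<in> demand A B d \<inter> set p" "h v + 2 < length p" by blast
      have "E u v" if "u \<in> B l \<inter> (V - R)" for u
        using layered_dominated_by_end[OF p tourn_subset[OF T] _ v(2) that] v by auto
      thus ?thesis using v False by (auto simp: demand_def)
    qed
    then obtain v where v: "v \<in> demand A B d \<inter> set p"
      "\<forall>u\<in>demand A B (fst d, l) \<inter> (V - R). if fst d then E v u else E u v" by blast
    have vR: "v \<in> V - R" using v p by (auto simp: layered_def walk_def)
    have dl: "demand A B (fst d', l) \<subseteq> V" for d' using l by (auto simp: demand_def)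
    have im: "(r(d := v)) ` insert d D' = insert v R" using d by (auto simp: R_def)
    have "ok (insert d D', r(d := v))"
    proof -
      have "inj_on (r(d := v)) (insert d D')"
        using Dr d vR by (auto simp: ok_def R_def inj_on_def)
      moreover have "\<forall>d'\<in>insert d D'. (r(d := v)) d' \<in> demand A B d'" using Dr v by (auto simp: ok_def)
      moreover have "\<forall>d'\<in>insert d D'. \<forall>u\<in>demand A B (fst d', l) - insert v R.
          if fst d' then E ((r(d := v)) d') u else E u ((r(d := v)) d')"
      proof (intro ballI)
        fix d' u assume d': "d' \<in> insert d D'" and u: "u \<in> demand A B (fst d', l) - insert v R"
        show "if fst d' then E ((r(d := v)) d') u else E u ((r(d := v)) d')"
        proof (cases "d' = d")
          case True
          thus ?thesis using v(2) u dl[of d] by auto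
        next
          case False
          have old: "\<forall>d\<in>D'. \<forall>u\<in>demand A B (fst d, l) - R. if fst d then E (r d) u else E u (r d)"
            using Dr unfolding ok_def prod.case R_def by (elim conjE)
          have "d' \<in> D'" "u \<in> demand A B (fst d', l) - R" using d' u False by auto
          from old[THEN bspec, OF this(1), THEN bspec, OF this(2)] show ?thesis using False by simp
        qed
      qed
      moreover have "D' \<subseteq> ?D0" using Dr unfolding ok_def by blast
      hence "insert d D' \<subseteq> ?D0" using d0 by blast
      moreover have "insert v R \<subseteq> V" using vR R(1) by blast
      ultimately show ?thesis unfolding ok_def prod.case im by (intro conjI)
    qed
    from max[OF this] show False using d fD' by simp
  qed
  hence "\<forall>d\<in>D - D'. card (demand A B d \<inter> set p) \<le> m + 1" by blast
  moreover have "D' \<subseteq> D" "inj_on r D'" "r ` D' \<subseteq> V" "\<forall>d\<in>D'. r d \<in> demand A B d"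
    using Dr unfolding ok_def by blast+
  moreover have "\<forall>d\<in>D'. \<forall>u\<in>demand A B (fst d, l) - r ` D'. if fst d then E (r d) u else E u (r d)"
    using Dr unfolding ok_def prod.case by (elim conjE)
  ultimately show ?thesis using small[OF Dr] p unfolding R_def
    by (intro exI[of _ D'] exI[of _ r] exI[of _ p] exI[of _ h] conjI)
qed

section \<open>Spanning linkages\<close>

definition spanning_linkage ::
    "'a set \<Rightarrow> ('a \<Rightarrow> 'a \<Rightarrow> bool) \<Rightarrow> 'i set \<Rightarrow> ('i \<Rightarrow> 'a set) \<Rightarrow> ('i \<Rightarrow> 'a set) \<Rightarrow> ('i \<Rightarrow> 'a list) \<Rightarrow> bool" where
  "spanning_linkage V E I A B f \<longleftrightarrow> (\<forall>i\<in>I. walk V E (A i) (B i) (f i) \<and> distinct (f i))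
     \<and> (\<forall>i\<in>I. \<forall>j\<in>I. i \<noteq> j \<longrightarrow> set (f i) \<inter> set (f j) = {}) \<and> (\<Union>i\<in>I. set (f i)) = V"

lemma card_le_remove:
  assumes "finite C"
  shows "card C \<le> card (C - R - P) + card (R \<inter> C) + card (C \<inter> P)"
proof -
  have "C = (C - R - P) \<union> (R \<inter> C) \<union> (C \<inter> P)" by auto
  hence "card C \<le> card ((C - R - P) \<union> (R \<inter> C)) + card (C \<inter> P)" by (metis card_Un_le)
  also have "\<dots> \<le> card (C - R - P) + card (R \<inter> C) + card (C \<inter> P)" using card_Un_le by auto
  finally show ?thesis .
qed

text \<open>The connectivity \<open>t\<close> left after the removal and the treatment of the other
  paths are hypotheses, because the step serves both in the induction and, with a better estimate of
  \<open>t\<close>, for the first path in the presence of the terminals.\<close>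

lemma linkage_step:
  fixes A B :: "'i \<Rightarrow> 'a set"
  assumes T: "tourn V E" and I: "finite I" "card I = Suc n"
    and AB: "\<And>i. i \<in> I \<Longrightarrow> A i \<subseteq> V \<and> B i \<subseteq> V"
    and big: "\<And>i. i \<in> I \<Longrightarrow> Suc n * Suc n + Suc n + 1 \<le> card (A i)"
      "\<And>i. i \<in> I \<Longrightarrow> Suc n * Suc n + Suc n + 1 \<le> card (B i)"
    and st: "\<And>R. R \<subseteq> V \<Longrightarrow> card R \<le> n \<Longrightarrow> strong (V - R) E"
    and rest: "\<And>l R p h. l \<in> I \<Longrightarrow> R \<subseteq> V \<Longrightarrow> card R \<le> n \<Longrightarrow>
      layered (V - R) E (A l) (B l) p h \<Longrightarrow> kconn t (V - R - set p) E"
    and IH: "\<And>J V' A' B'. J \<subseteq> I \<Longrightarrow> card J = n \<Longrightarrow> V' \<subseteq> V \<Longrightarrow> kconn t V' E \<Longrightarrow>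
      (\<And>j. j \<in> J \<Longrightarrow> A' j \<subseteq> V' \<and> B' j \<subseteq> V') \<Longrightarrow>
      (\<And>j. j \<in> J \<Longrightarrow> n * n + n + 1 \<le> card (A' j) \<and> n * n + n + 1 \<le> card (B' j)) \<Longrightarrow>
      \<exists>f. spanning_linkage V' E J A' B' f"
  shows "\<exists>f. spanning_linkage V E I A B f"
proof -
  have fin: "finite V" using T by (simp add: tourn_def)
  let ?m = "Suc n"
  let ?sw = "\<lambda>i C. swallows ?m V E (A i) (B i) C"
  have "\<exists>l\<in>I. card {j \<in> I. j \<noteq> l \<and> ?sw l (A j)} + card {j \<in> I. j \<noteq> l \<and> ?sw l (B j)} < card I"
  proof (rule averaging[OF I(1)])
    show "I \<noteq> {}" using I by auto
    show "\<not> (?sw i (A j) \<and> ?sw j (A i))" for i j using swallows_start_antisym[OF T] by blast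
    show "\<not> (?sw i (B j) \<and> ?sw j (B i))" for i j using swallows_end_antisym[OF T] by blast
  qed
  then obtain l where l: "l \<in> I"
    and few: "card {j \<in> I. j \<noteq> l \<and> ?sw l (A j)} + card {j \<in> I. j \<noteq> l \<and> ?sw l (B j)} < card I"
    by blast
  define J where "J = I - {l}"
  define D where "D = (UNIV :: bool set) \<times> J"
  have J: "J \<subseteq> I" "card J = n" "finite J" "l \<notin> J" using I l by (auto simp: J_def)
  have "{d \<in> D. ?sw l (demand A B d)}
      = {True} \<times> {j \<in> I. j \<noteq> l \<and> ?sw l (A j)} \<union> {False} \<times> {j \<in> I. j \<noteq> l \<and> ?sw l (B j)}"
    by (auto simp: D_def J_def demand_def)
  hence "card {d \<in> D. ?sw l (demand A B d)}
      \<le> card ({True} \<times> {j \<in> I. j \<noteq> l \<and> ?sw l (A j)}) + card ({False} \<times> {j \<in> I. j \<noteq> l \<and> ?sw l (B j)})"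
    by (simp only: card_Un_le)
  hence Dsmall: "card {d \<in> D. ?sw l (demand A B d)} < ?m"
    using few I by (simp add: card_cartesian_product)
  have "finite D" using J by (simp add: D_def)
  moreover have "?m \<le> card (A l)" "?m \<le> card (B l)" using big(1)[OF l] big(2)[OF l] by linarith+
  ultimately have "\<exists>D' r p h. D' \<subseteq> D \<and> card D' < ?m \<and> inj_on r D' \<and> r ` D' \<subseteq> V
    \<and> (\<forall>d\<in>D'. r d \<in> demand A B d)
    \<and> (\<forall>d\<in>D'. \<forall>u\<in>demand A B (fst d, l) - r ` D'. if fst d then E (r d) u else E u (r d))
    \<and> layered (V - r ` D') E (A l) (B l) p h
    \<and> (\<forall>d\<in>D - D'. card (demand A B d \<inter> set p) \<le> ?m + 1)"
    using AB[OF l] st Dsmall by (intro reserve[OF T]) (simp_all add: less_Suc_eq_le)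
  then obtain D' r p h where D': "D' \<subseteq> D" "card D' < ?m" "inj_on r D'" "r ` D' \<subseteq> V"
    and rC: "\<forall>d\<in>D'. r d \<in> demand A B d"
    and dom: "\<forall>d\<in>D'. \<forall>u\<in>demand A B (fst d, l) - r ` D'. if fst d then E (r d) u else E u (r d)"
    and p: "layered (V - r ` D') E (A l) (B l) p h"
    and free: "\<forall>d\<in>D - D'. card (demand A B d \<inter> set p) \<le> ?m + 1"
    by (elim exE conjE) (rule that)
  note rC = bspec[OF rC] and dom = bspec[OF bspec[OF dom]] and free = bspec[OF free]
  define R where "R = r ` D'"
  have fD': "finite D'" using D' \<open>finite D\<close> finite_subset by blast
  have fR: "finite R" and R: "R \<subseteq> V" "card R \<le> n"
    using fD' D' card_image_le[OF fD', of r] by (auto simp: R_def)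
  define V' where "V' = V - R - set p"
  have pV: "set p \<subseteq> V - R" "distinct p" "p \<noteq> []" "successively E p" "hd p \<in> A l" "last p \<in> B l"
    using p layered_distinct[OF p] by (auto simp: layered_def walk_def R_def)
  \<comment> \<open>A reserved vertex will be put in front of the \<open>j\<close>-th path, which
    therefore has to continue at one of its out-neighbours.\<close>
  define A' where "A' j = (if (True, j) \<in> D' then {u \<in> V'. E (r (True, j)) u} else A j \<inter> V')" for j
  define B' where "B' j = (if (False, j) \<in> D' then {u \<in> V'. E u (r (False, j))} else B j \<inter> V')" for j
  have kV': "kconn t V' E" using rest[OF l R p[folded R_def]] by (simp add: V'_def)
  have RC: "card (R \<inter> C) \<le> n" for C using R fR card_mono[of R "R \<inter> C"] by auto
  \<comment> \<open>If nothing is reserved for \<open>A j\<close>, it loses at most \<open>n\<close>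
    vertices to \<open>R\<close> and \<open>n + 2\<close> to \<open>p\<close>, exactly the
    difference between the two bounds. Otherwise \<open>A' j\<close> contains \<open>A l\<close> up
    to \<open>R\<close> and the single vertex of \<open>A l\<close> on \<open>p\<close>.\<close>
  have sizeA: "n * n + n + 1 \<le> card (A' j)" if j: "j \<in> J" for j
  proof (cases "(True, j) \<in> D'")
    case True
    have "A l - R - set p \<subseteq> A' j"
      using dom[OF True] True AB[OF l] by (auto simp: A'_def V'_def demand_def R_def)
    hence "card (A l - R - set p) \<le> card (A' j)"
      using fin by (intro card_mono) (auto simp: A'_def V'_def)
    moreover have "finite (A l)" using AB[OF l] fin finite_subset by blast
    ultimately show ?thesis
      using card_le_remove[of "A l" R "set p"] RC[of "A l"] layered_start_card[OF p] big(1)[OF l] by simp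
  next
    case False
    have "(True, j) \<in> D - D'" using j False by (auto simp: D_def)
    from free[OF this] have "card (A j \<inter> set p) \<le> ?m + 1" by (simp add: demand_def)
    moreover have jI: "j \<in> I" using j J by auto
    have "A j - R - set p = A' j" using False AB[OF jI] by (auto simp: A'_def V'_def)
    moreover have "finite (A j)" using AB[OF jI] fin finite_subset by blast
    ultimately show ?thesis
      using card_le_remove[of "A j" R "set p"] RC[of "A j"] big(1)[OF jI] by simp
  qed
  have sizeB: "n * n + n + 1 \<le> card (B' j)" if j: "j \<in> J" for j
  proof (cases "(False, j) \<in> D'")
    case True
    have "B l - R - set p \<subseteq> B' j"
      using dom[OF True] True AB[OF l] by (auto simp: B'_def V'_def demand_def R_def)
    hence "card (B l - R - set p) \<le> card (B' j)"
      using fin by (intro card_mono) (auto simp: B'_def V'_def)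
    moreover have "finite (B l)" using AB[OF l] fin finite_subset by blast
    ultimately show ?thesis
      using card_le_remove[of "B l" R "set p"] RC[of "B l"] layered_end_card[OF p] big(2)[OF l] by simp
  next
    case False
    have "(False, j) \<in> D - D'" using j False by (auto simp: D_def)
    from free[OF this] have "card (B j \<inter> set p) \<le> ?m + 1" by (simp add: demand_def)
    moreover have jI: "j \<in> I" using j J by auto
    have "B j - R - set p = B' j" using False AB[OF jI] by (auto simp: B'_def V'_def)
    moreover have "finite (B j)" using AB[OF jI] fin finite_subset by blast
    ultimately show ?thesis
      using card_le_remove[of "B j" R "set p"] RC[of "B j"] big(2)[OF jI] by simp
  qed
  have "\<exists>f. spanning_linkage V' E J A' B' f"
  proof (rule IH[OF J(1,2) _ kV'])
    show "V' \<subseteq> V" by (auto simp: V'_def)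
    show "A' j \<subseteq> V' \<and> B' j \<subseteq> V'" for j by (auto simp: A'_def B'_def)
    show "n * n + n + 1 \<le> card (A' j) \<and> n * n + n + 1 \<le> card (B' j)" if "j \<in> J" for j
      using sizeA sizeB that by blast
  qed
  then obtain f where f: "spanning_linkage V' E J A' B' f" by blast
  \<comment> \<open>The reserved vertices return as first and last vertices of their paths.\<close>
  define pre where "pre j = (if (True, j) \<in> D' then [r (True, j)] else [])" for j
  define post where "post j = (if (False, j) \<in> D' then [r (False, j)] else [])" for j
  define g where "g j = (if j = l then p else pre j @ f j @ post j)" for j
  have fw: "set (f j) \<subseteq> V'" "f j \<noteq> []" "successively E (f j)" "hd (f j) \<in> A' j" "last (f j) \<in> B' j" "distinct (f j)"
    if "j \<in> J" for j using f that by (auto simp: spanning_linkage_def walk_def)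
  have setpp: "set (pre j) \<union> set (post j) = r ` {d \<in> D'. snd d = j}" for j
  proof -
    have "{d \<in> D'. snd d = j} = (if (True, j) \<in> D' then {(True, j)} else {}) \<union> (if (False, j) \<in> D' then {(False, j)} else {})"
      by auto (metis (full_types))+
    thus ?thesis by (auto simp: pre_def post_def)
  qed
  have setg: "set (g j) = set (f j) \<union> r ` {d \<in> D'. snd d = j}" if "j \<in> J" for j
    using that J(4) setpp[of j] by (auto simp: g_def)
  have RV': "R \<inter> V' = {}" by (auto simp: V'_def)
  have gw: "walk V E (A j) (B j) (g j) \<and> distinct (g j)" if j: "j \<in> I" for j
  proof (cases "j = l")
    case True
    thus ?thesis using pV by (auto simp: g_def walk_def)
  next
    case False
    hence jJ: "j \<in> J" using j by (simp add: J_def)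
    have "set (g j) \<subseteq> V" using setg[OF jJ] fw(1)[OF jJ] D'(4) by (auto simp: V'_def)
    moreover have "successively E (pre j @ f j @ post j)"
      using fw[OF jJ] by (auto simp: pre_def post_def A'_def B'_def successively_append_iff successively_Cons)
    moreover have "hd (pre j @ f j @ post j) \<in> A j"
      using fw[OF jJ] rC[of "(True, j)"] by (auto simp: pre_def A'_def demand_def)
    moreover have "last (pre j @ f j @ post j) \<in> B j"
      using fw[OF jJ] rC[of "(False, j)"] by (auto simp: post_def B'_def demand_def)
    moreover have "distinct (pre j @ f j @ post j)"
    proof -
      have "r d \<notin> set (f j)" if "d \<in> D'" for d
        using that RV' fw(1)[OF jJ] by (auto simp: R_def)
      moreover have "r (True, j) \<noteq> r (False, j)" if "(True, j) \<in> D'" "(False, j) \<in> D'"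
        using inj_onD[OF D'(3) _ that] by auto
      ultimately show ?thesis using fw(6)[OF jJ] by (auto simp: pre_def post_def)
    qed
    ultimately show ?thesis using False fw(2)[OF jJ] by (simp add: g_def walk_def)
  qed
  have gdl: "set (g j) \<inter> set (g l) = {}" if "j \<in> J" for j
    using setg[OF that] fw(1)[OF that] pV(1) by (auto simp: g_def V'_def R_def)
  have gd: "set (g i) \<inter> set (g j) = {}" if "i \<in> J" "j \<in> J" "i \<noteq> j" for i j
  proof -
    have "set (f i) \<inter> set (f j) = {}" using f that by (auto simp: spanning_linkage_def)
    moreover have "r ` {d \<in> D'. snd d = i} \<inter> r ` {d \<in> D'. snd d = j} = {}"
      using that(3) D'(3) by (auto simp: inj_on_def)
    moreover have "set (f i) \<inter> R = {}" "set (f j) \<inter> R = {}"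
      using RV' fw(1)[OF that(1)] fw(1)[OF that(2)] by auto
    ultimately show ?thesis unfolding setg[OF that(1)] setg[OF that(2)] R_def by blast
  qed
  have "(\<Union>j\<in>I. set (g j)) = V"
  proof -
    have "(\<Union>j\<in>J. set (g j)) = (\<Union>j\<in>J. set (f j)) \<union> (\<Union>j\<in>J. r ` {d \<in> D'. snd d = j})"
      using setg by auto
    also have "(\<Union>j\<in>J. set (f j)) = V'" using f by (simp add: spanning_linkage_def)
    also have "(\<Union>j\<in>J. r ` {d \<in> D'. snd d = j}) = R" using D'(1) by (auto simp: R_def D_def)
    finally have "(\<Union>j\<in>J. set (g j)) = V' \<union> R" .
    moreover have "I = insert l J" using l by (auto simp: J_def)
    moreover have "set (g l) = set p" by (simp add: g_def)
    ultimately show ?thesis using R pV(1) by (auto simp: V'_def)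
  qed
  moreover have "set (g i) \<inter> set (g j) = {}" if "i \<in> I" "j \<in> I" "i \<noteq> j" for i j
    using that gd[of i j] gdl[of i] gdl[of j] by (cases "i = l"; cases "j = l") (auto simp: J_def)
  ultimately have "spanning_linkage V E I A B g" using gw unfolding spanning_linkage_def by blast
  thus ?thesis by blast
qed

text \<open>Going from \<open>n + 1\<close> to \<open>n\<close> paths costs \<open>n\<close> in
  connectivity for the reserved vertices and four for the path, and \<open>n * n + 7 * n\<close>
  drops by exactly twice that. For \<open>n = 1\<close> the condition says \<open>3 \<le> t\<close>,
  as the Hamiltonian path requires.\<close>

lemma spanning_linkage_exists:
  assumes "tourn V E" "finite I" "card I = n" "0 < n" "kconn t V E" "n * n + 7 * n \<le> 2 * t + 2"
    and "\<And>i. i \<in> I \<Longrightarrow> A i \<subseteq> V \<and> B i \<subseteq> V"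
    and "\<And>i. i \<in> I \<Longrightarrow> n * n + n + 1 \<le> card (A i) \<and> n * n + n + 1 \<le> card (B i)"
  shows "\<exists>f. spanning_linkage V E I A B f"
  using assms
proof (induction n arbitrary: V I A B t)
  case 0
  thus ?case by simp
next
  case (Suc n)
  note T = Suc.prems(1) and k = Suc.prems(5) and AB = Suc.prems(7) and big = Suc.prems(8)
  have fin: "finite V" using T by (simp add: tourn_def)
  show ?case
  proof (cases "n = 0")
    case True
    then obtain i where i: "I = {i}" using Suc.prems by (auto simp: card_1_singleton_iff)
    have "3 \<le> t" using Suc.prems(6) True by simp
    hence "kconn 3 V E" using k kconn_mono by blast
    then obtain q where "walk V E (A i) (B i) q" "distinct q" "set q = V"
      using hamiltonian_path_kconn[OF T, of "A i" "B i"] AB[of i] big[of i] i True by auto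
    thus ?thesis unfolding spanning_linkage_def i by (intro exI[of _ "\<lambda>_. q"]) auto
  next
    case False
    have t: "n + 7 \<le> t"
    proof -
      obtain c where "n = Suc c" using False by (cases n) auto
      thus ?thesis using Suc.prems(6) by (simp add: algebra_simps)
    qed
    define t' where "t' = t - n - 4"
    show ?thesis
    proof (rule linkage_step[OF T Suc.prems(2,3) AB, where t = t'])
      show "Suc n * Suc n + Suc n + 1 \<le> card (A i)" "Suc n * Suc n + Suc n + 1 \<le> card (B i)" if "i \<in> I" for i
        using big[OF that] by auto
      show "strong (V - R) E" if "R \<subseteq> V" "card R \<le> n" for R
        using k that t unfolding kconn_def by auto
      show "kconn t' (V - R - set p) E"
        if "l \<in> I" "R \<subseteq> V" "card R \<le> n" "layered (V - R) E (A l) (B l) p h" for l R p h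
      proof -
        have "kconn (t - n) (V - R) E" by (rule kconn_remove[OF k fin that(2)]) (use that t in linarith)
        moreover have "tourn (V - R) E" using tourn_subset[OF T] by blast
        ultimately have "kconn (t - n - 4) (V - R - set p) E"
          using that(4) t by (intro kconn_remove_layered[where h = h]) (auto simp: layered_def walk_def)
        thus ?thesis by (simp add: t'_def)
      qed
      fix J V' and A' B' :: "'b \<Rightarrow> 'a set"
      assume J: "J \<subseteq> I" "card J = n" and V': "V' \<subseteq> V" "kconn t' V' E"
        and AB': "\<And>j. j \<in> J \<Longrightarrow> A' j \<subseteq> V' \<and> B' j \<subseteq> V'"
        and big': "\<And>j. j \<in> J \<Longrightarrow> n * n + n + 1 \<le> card (A' j) \<and> n * n + n + 1 \<le> card (B' j)"
      have "n * n + 7 * n \<le> 2 * t' + 2" using Suc.prems(6) t by (simp add: t'_def)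
      moreover have "finite J" using J Suc.prems(2) finite_subset by blast
      ultimately show "\<exists>f. spanning_linkage V' E J A' B' f"
        using False AB' big' by (intro Suc.IH[OF tourn_subset[OF T V'(1)] _ J(2) _ V'(2)]) auto
    qed
  qed
qed

section \<open>From linkages to the theorem\<close>

lemma tournament_imp_tourn: "tournament V E \<Longrightarrow> tourn V E"
proof -
  assume "tournament V E"
  note t = this[unfolded tournament_def]
  have "\<forall>v\<in>V. \<not> E v v" using t[THEN conjunct2, THEN conjunct2, THEN conjunct1] by blast
  thus ?thesis unfolding tourn_def
    by (intro conjI t[THEN conjunct1] t[THEN conjunct2, THEN conjunct2, THEN conjunct2])
qed

text \<open>A path that starts in \<open>S\<close> could never leave it.\<close>

lemma strong_if_dpaths:
  assumes "\<And>x y. x \<in> U \<Longrightarrow> y \<in> U \<Longrightarrow> \<exists>P. dpath_from_to U E P x y"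
  shows "strong U E"
  unfolding strong_def
proof (intro allI impI, rule ccontr)
  fix S assume S: "S \<subseteq> U" "S \<noteq> {}" "S \<noteq> U" and no: "\<not> (\<exists>u\<in>S. \<exists>v\<in>U - S. E u v)"
  then obtain x y where xy: "x \<in> S" "y \<in> U - S" by blast
  then obtain P where P: "P \<noteq> []" "set P \<subseteq> U" "hd P = x" "last P = y"
    "\<And>i. Suc i < length P \<Longrightarrow> E (P ! i) (P ! Suc i)"
    using assms[of x y] S unfolding dpath_from_to_def dpath_def by blast
  have "P ! i \<in> S" if "i < length P" for i
    using that
  proof (induction i)
    case 0
    thus ?case using P xy by (simp add: hd_conv_nth)
  next
    case (Suc i)
    have "P ! Suc i \<in> U" using Suc.prems P(2) nth_mem by blast
    thus ?case using Suc P(5)[OF Suc.prems] no by auto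
  qed
  hence "last P \<in> S" using P(1) by (simp add: last_conv_nth)
  thus False using P(4) xy by simp
qed

lemma strongly_connected_imp_kconn: "strongly_connected_k t V E \<Longrightarrow> kconn t V E"
  unfolding strongly_connected_k_def kconn_def by (auto intro!: strong_if_dpaths)

theorem theorem1p4:
  fixes V :: "'a set" and E :: "'a \<Rightarrow> 'a \<Rightarrow> bool" and k :: nat
    and x y :: "nat \<Rightarrow> 'a"
  assumes "k \<ge> 1"
    and "tournament V E"
    and "strongly_connected_k (k^2 + 3*k) V E"
    and "\<forall>i\<in>{1..k}. x i \<in> V \<and> y i \<in> V"
    and "\<forall>i\<in>{1..k}. x i \<noteq> y i"
    and "\<forall>i\<in>{1..k}. \<forall>j\<in>{1..k}. i \<noteq> j \<longrightarrow> (x i, y i) \<noteq> (x j, y j)"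
  shows "\<exists>P :: nat \<Rightarrow> 'a list.
           (\<forall>i\<in>{1..k}. dpath_from_to V E (P i) (x i) (y i))
         \<and> (\<forall>i\<in>{1..k}. \<forall>j\<in>{1..k}. i \<noteq> j \<longrightarrow> interior (P i) \<inter> set (P j) = {})
         \<and> (\<forall>i\<in>{1..k}. (x ` {1..k} \<union> y ` {1..k}) \<inter> set (P i) = {x i, y i})
         \<and> V = (\<Union>i\<in>{1..k}. set (P i))"
proof -
  have T: "tourn V E" using assms(2) by (rule tournament_imp_tourn)
  have kc: "kconn (k * k + 3 * k) V E"
    using strongly_connected_imp_kconn[OF assms(3)] by (simp add: power2_eq_square)
  have fin: "finite V" and irr: "\<And>v. v \<in> V \<Longrightarrow> \<not> E v v" using T by (auto simp: tourn_def)
  define I where "I = {1..k}"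
  have I: "finite I" "card I = k" by (auto simp: I_def)
  have xyV: "x i \<in> V" "y i \<in> V" "x i \<noteq> y i" if "i \<in> I" for i
    using assms(4,5) that by (auto simp: I_def)
  define Z where "Z = x ` I \<union> y ` I"
  define H where "H = V - Z"
  have fZ: "finite Z" and ZV: "Z \<subseteq> V" using I xyV by (auto simp: Z_def)
  have TH: "tourn H E" and HV: "H \<subseteq> V" using tourn_subset[OF T] by (auto simp: H_def)
  have card_terminals: "card (x ` J \<union> y ` J) \<le> 2 * card J" if "finite J" for J
    using card_Un_le[of "x ` J" "y ` J"] card_image_le[OF that, of x] card_image_le[OF that, of y] by linarith
  have cZ: "card Z \<le> 2 * k" using card_terminals[OF I(1)] I by (simp add: Z_def)
  have kH: "kconn (k * k + k) H E" unfolding H_def by (rule kconn_remove[OF kc fin ZV]) (use cZ in simp)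
  define A where "A i = {v \<in> H. E (x i) v}" for i
  define B where "B i = {v \<in> H. E v (y i)}" for i
  have AB: "A i \<subseteq> H \<and> B i \<subseteq> H" for i by (auto simp: A_def B_def)
  have Zminus: "card (Z - {z}) + 1 \<le> 2 * k" if "z \<in> Z" for z
    using card_Diff_singleton[OF that] cZ fZ that card_gt_0_iff[of Z] by fastforce
  \<comment> \<open>Since \<open>x i\<close> is not its own out-neighbour, at most
    \<open>2 * k - 1\<close> terminals are lost; this yields the summand 1.\<close>
  have bigA: "k * k + k + 1 \<le> card (A i)" if i: "i \<in> I" for i
  proof -
    have "k * k + 3 * k \<le> card {u \<in> V. E (x i) u}"
      using kconn_outdegree[OF kc fin] xyV[OF i] irr by blast
    also have "\<dots> \<le> card (A i \<union> (Z - {x i}))"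
      using fin fZ irr HV by (intro card_mono) (auto simp: A_def H_def intro: finite_subset)
    also have "\<dots> \<le> card (A i) + card (Z - {x i})" by (rule card_Un_le)
    finally show ?thesis using Zminus[of "x i"] i by (simp add: Z_def)
  qed
  have bigB: "k * k + k + 1 \<le> card (B i)" if i: "i \<in> I" for i
  proof -
    have "k * k + 3 * k \<le> card {u \<in> V. E u (y i)}"
      using kconn_indegree[OF kc fin] xyV[OF i] irr by blast
    also have "\<dots> \<le> card (B i \<union> (Z - {y i}))"
      using fin fZ irr HV by (intro card_mono) (auto simp: B_def H_def intro: finite_subset)
    also have "\<dots> \<le> card (B i) + card (Z - {y i})" by (rule card_Un_le)
    finally show ?thesis using Zminus[of "y i"] i by (simp add: Z_def)
  qed
  \<comment> \<open>The lists \<open>f i\<close> are the interiors of the required paths and may be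
    empty.\<close>
  have "\<exists>f. (\<forall>i\<in>I. distinct (f i) \<and> set (f i) \<subseteq> H \<and> successively E (x i # f i @ [y i]))
      \<and> (\<forall>i\<in>I. \<forall>j\<in>I. i \<noteq> j \<longrightarrow> set (f i) \<inter> set (f j) = {}) \<and> (\<Union>i\<in>I. set (f i)) = H"
    (is "\<exists>f. ?good f")
  proof -
    have succ: "successively E (x i # p @ [y i])" "set p \<subseteq> H" if "walk H E (A i) (B i) p" for i p
      using that by (auto simp: walk_def A_def B_def successively_Cons successively_append_iff)
    have good: "\<exists>f. ?good f" if "spanning_linkage H E I A B f" for f
    proof (rule exI[of _ f])
      show "?good f" using that succ unfolding spanning_linkage_def by blast
    qed
    \<comment> \<open>An edge from \<open>x l\<close> to \<open>y l\<close> is a path that uses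
      nothing of \<open>H\<close>, and for the remaining \<open>k - 1\<close> paths the connectivity
      of \<open>H\<close> suffices. If there is no such edge, the first path is removed together
      with its terminals, which is cheaper. One pair is handled directly.\<close>
    consider "k = 1" | n l where "k = Suc n" "0 < n" "l \<in> I" "E (x l) (y l)"
      | n where "k = Suc n" "0 < n" "\<And>l. l \<in> I \<Longrightarrow> \<not> E (x l) (y l)"
      using assms(1) by (cases k) auto
    thus ?thesis
    proof cases
      case 1
      hence I1: "I = {1}" by (auto simp: I_def)
      have Z1: "Z = {x 1, y 1}" by (auto simp: Z_def I1)
      have "\<exists>r. walk H E (A 1) (B 1) r \<and> distinct r \<and> set r = H"
      proof (rule hamiltonian_path[OF TH])
        show "strong H E" using kH 1 by (intro kconn_strong) auto
        show "A 1 \<subseteq> H" "B 1 \<subseteq> H" using AB by auto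
        fix S assume S: "S \<subseteq> H" "card S < 3"
        have fS: "finite S" by (rule finite_subset[OF S(1) finite_subset[OF HV fin]])
        define U where "U = V - insert (y 1) S"
        have "insert (y 1) S \<subseteq> V" using S HV xyV I1 by auto
        moreover have "card (insert (y 1) S) < k * k + 3 * k" using S fS 1 by (simp add: card_insert_if)
        ultimately have stU: "strong U E" using kc by (auto simp: kconn_def U_def)
        \<comment> \<open>\<open>H\<close> is too weakly connected here, so the four-connectivity of
          \<open>V\<close> is used: after deleting \<open>S\<close> and \<open>y 1\<close>,
          everything is reached from \<open>x 1\<close>, and after leaving \<open>x 1\<close> the
          walk stays in \<open>H - S\<close>.\<close>
        define X where "X = insert (x 1) {v \<in> H - S. \<exists>p. walk (H - S) E (A 1) {v} p}"
        have "X \<subseteq> U" using S xyV[of 1] I1 by (auto simp: X_def U_def H_def Z1)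
        moreover have "X \<noteq> {}" by (simp add: X_def)
        moreover have "\<not> (\<exists>u\<in>X. \<exists>v\<in>U - X. E u v)"
        proof
          assume "\<exists>u\<in>X. \<exists>v\<in>U - X. E u v"
          then obtain u v where uv: "u \<in> X" "v \<in> U - X" "E u v" by blast
          hence v: "v \<in> H - S" by (auto simp: U_def X_def H_def Z1)
          have "\<exists>p. walk (H - S) E (A 1) {v} p"
          proof (cases "u = x 1")
            case True
            hence "walk (H - S) E (A 1) {v} [v]" using uv v by (auto simp: walk_def A_def)
            thus ?thesis by blast
          next
            case False
            then obtain p where p: "walk (H - S) E (A 1) {u} p" using uv by (auto simp: X_def)
            hence "E (last p) v" using uv by (auto simp: walk_def)
            thus ?thesis using walk_snoc[OF p _ v] by blast
          qed
          thus False using uv v by (auto simp: X_def)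
        qed
        ultimately have XU: "X = U" using stU unfolding strong_def by blast
        have "\<not> B 1 \<subseteq> S" using card_mono[OF fS, of "B 1"] bigB[of 1] S 1 I1 by auto
        then obtain b where b: "b \<in> B 1" "b \<in> H - S" by (auto simp: B_def)
        hence "b \<in> X" unfolding XU by (auto simp: U_def H_def Z1)
        then obtain p where "walk (H - S) E (A 1) {b} p" using b by (auto simp: X_def H_def Z1)
        thus "\<exists>p. walk (H - S) E (A 1) (B 1) p" using b by (auto simp: walk_def)
      qed
      then obtain r where "walk H E (A 1) (B 1) r" "distinct r" "set r = H" by blast
      hence "spanning_linkage H E I A B (\<lambda>_. r)" by (simp add: spanning_linkage_def I1)
      thus ?thesis by (rule good)
    next
      case (2 n l)
      have "\<exists>f. spanning_linkage H E (I - {l}) A B f"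
      proof (rule spanning_linkage_exists[OF TH _ _ 2(2) kH])
        show "finite (I - {l})" "card (I - {l}) = n" using I 2 by auto
        show "n * n + 7 * n \<le> 2 * (k * k + k) + 2" using 2(1) by (cases n) (auto simp: algebra_simps)
        show "n * n + n + 1 \<le> card (A i) \<and> n * n + n + 1 \<le> card (B i)" if "i \<in> I - {l}" for i
          using bigA[of i] bigB[of i] that 2(1) by auto
      qed (rule AB)
      then obtain f where f: "spanning_linkage H E (I - {l}) A B f" by blast
      have "?good (f(l := []))"
      proof (intro conjI ballI impI)
        fix i assume i: "i \<in> I"
        show "distinct ((f(l := [])) i)" "set ((f(l := [])) i) \<subseteq> H"
          "successively E (x i # (f(l := [])) i @ [y i])"
          using f i succ[of i "f i"] 2(4) by (auto simp: spanning_linkage_def)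
        fix j assume "j \<in> I" "i \<noteq> j"
        thus "set ((f(l := [])) i) \<inter> set ((f(l := [])) j) = {}"
          using f i by (auto simp: spanning_linkage_def)
      next
        have "(\<Union>i\<in>I. set ((f(l := [])) i)) = (\<Union>i\<in>I - {l}. set (f i))"
          by (auto split: if_splits)
        thus "(\<Union>i\<in>I. set ((f(l := [])) i)) = H" using f by (simp add: spanning_linkage_def)
      qed
      thus ?thesis by (rule exI[of _ "f(l := [])"])
    next
      case (3 n)
      have "\<exists>f. spanning_linkage H E I A B f"
      proof (rule linkage_step[OF TH I(1) _ AB, where t = "k * k - 1"])
        show "card I = Suc n" using I 3 by simp
        show "Suc n * Suc n + Suc n + 1 \<le> card (A i)" "Suc n * Suc n + Suc n + 1 \<le> card (B i)" if "i \<in> I" for i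
          using bigA[OF that] bigB[OF that] 3(1) by auto
        show "strong (H - R) E" if "R \<subseteq> H" "card R \<le> n" for R
          using kH that 3(1) unfolding kconn_def by auto
      next
        fix l R p h
        assume l: "l \<in> I" and R: "R \<subseteq> H" "card R \<le> n" and p: "layered (H - R) E (A l) (B l) p h"
        define Z' where "Z' = Z - {x l, y l}"
        \<comment> \<open>\<open>x l\<close> and \<open>y l\<close> are kept, so at most
          \<open>3 * n\<close> vertices are deleted from \<open>V\<close>. Taking them out with the
          path then leaves connectivity \<open>k * k - 1\<close>, whereas counting inside
          \<open>H\<close> would give only \<open>k * k - 3\<close>.\<close>
        define G where "G = V - (Z' \<union> R)"
        have "Z' \<subseteq> x ` (I - {l}) \<union> y ` (I - {l})" by (auto simp: Z'_def Z_def)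
        hence "card Z' \<le> card (x ` (I - {l}) \<union> y ` (I - {l}))" using I by (intro card_mono) auto
        hence "card Z' \<le> 2 * n" using card_terminals[of "I - {l}"] I l 3(1) by simp
        hence "card (Z' \<union> R) \<le> 3 * n" using card_Un_le[of Z' R] R by linarith
        hence "card (Z' \<union> R) + (k * k + 3) \<le> k * k + 3 * k" using 3(1) by simp
        moreover have "Z' \<union> R \<subseteq> V" using R HV ZV by (auto simp: Z'_def)
        ultimately have kG: "kconn (k * k + 3) G E"
          unfolding G_def using kconn_remove[OF kc fin] by blast
        have xyH: "x l \<notin> H" "y l \<notin> H" using l by (auto simp: H_def Z_def)
        have G: "G = insert (x l) (insert (y l) (H - R))"
          using R xyV[OF l] xyH l by (auto simp: G_def Z'_def H_def)
        have pH: "set p \<subseteq> H - R" "p \<noteq> []" using p by (auto simp: layered_def walk_def)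
        \<comment> \<open>The levels are shifted by one to make room for \<open>x l\<close> below
          and \<open>y l\<close> on top. Only an edge from \<open>x l\<close> to \<open>y l\<close>
          could skip levels, and in this case there is none.\<close>
        define h' where "h' v = (if v = x l then 0 else if v = y l then Suc (length p) else Suc (h v))" for v
        define p' where "p' = x l # p @ [y l]"
        have "kconn (k * k + 3 - 4) (G - set p') E"
        proof (rule kconn_remove_layered[OF tourn_subset[OF T] kG, where h = h'])
          show "G \<subseteq> V" by (auto simp: G_def)
          show "5 \<le> k * k + 3" using 3(1,2) by (cases n) auto
          show "set p' \<subseteq> G" using pH by (auto simp: p'_def G)
          show "h' (p' ! i) = i" if i: "i < length p'" for i
          proof (cases i)
            case 0
            thus ?thesis by (simp add: p'_def h'_def)
          next
            case (Suc j)
            show ?thesis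
            proof (cases "j < length p")
              case True
              hence "p ! j \<in> H" using pH nth_mem by blast
              moreover have "h (p ! j) = j" using p True by (simp add: layered_def)
              ultimately show ?thesis using Suc True xyH by (auto simp: p'_def h'_def nth_append)
            next
              case False
              hence "j = length p" using i Suc by (simp add: p'_def)
              thus ?thesis using Suc xyV[OF l] by (simp add: p'_def h'_def)
            qed
          qed
          fix u v assume uv: "u \<in> G" "v \<in> G" "E u v"
          have hlt: "h w < length p" for w using p by (simp add: layered_def)
          consider "v = x l" | "v = y l" "u = y l" | "v = y l" "u = x l" | "v = y l" "u \<in> H - R"
            | "v \<in> H - R" "u = x l" | "v \<in> H - R" "u = y l" | "v \<in> H - R" "u \<in> H - R"
            using uv by (auto simp: G)
          thus "h' v \<le> Suc (h' u)"
          proof cases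
            case 4
            hence "u \<in> B l \<inter> (H - R)" using uv by (auto simp: B_def)
            hence "length p \<le> Suc (h u)" using p by (simp add: layered_def)
            thus ?thesis using 4 xyH by (auto simp: h'_def)
          next
            case 5
            hence "v \<in> A l \<inter> (H - R)" using uv by (auto simp: A_def)
            hence "h v = 0" using p by (simp add: layered_def)
            thus ?thesis using 5 xyH by (auto simp: h'_def)
          next
            case 6
            thus ?thesis using hlt[of v] xyH xyV[OF l] by (auto simp: h'_def)
          next
            case 7
            hence "h v \<le> Suc (h u)" using p uv by (simp add: layered_def)
            thus ?thesis using 7 xyH by (auto simp: h'_def)
          qed (use 3(3)[OF l] uv in \<open>auto simp: h'_def\<close>)
        qed
        moreover have "G - set p' = H - R - set p" using xyH pH by (auto simp: p'_def G)
        ultimately show "kconn (k * k - 1) (H - R - set p) E" by simp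
      next
        fix J H' and A' B' :: "nat \<Rightarrow> 'a set"
        assume J: "J \<subseteq> I" "card J = n" and H': "H' \<subseteq> H" "kconn (k * k - 1) H' E"
          and AB': "\<And>j. j \<in> J \<Longrightarrow> A' j \<subseteq> H' \<and> B' j \<subseteq> H'"
          and big': "\<And>j. j \<in> J \<Longrightarrow> n * n + n + 1 \<le> card (A' j) \<and> n * n + n + 1 \<le> card (B' j)"
        \<comment> \<open>This is what the bound of \<open>spanning_linkage_exists\<close> amounts
          to for \<open>k = n + 1\<close>; it is tight for \<open>n = 1\<close> and
          \<open>n = 2\<close>.\<close>
        have "3 * n \<le> n * n + 2"
        proof (cases "n < 3")
          case True
          hence "n \<in> {0, 1, 2}" by auto
          thus ?thesis by auto
        next
          case False
          hence "3 \<le> n" by simp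
          from mult_le_mono1[OF this, of n] show ?thesis by linarith
        qed
        hence "n * n + 7 * n \<le> 2 * (k * k - 1) + 2" using 3(1) by (simp add: algebra_simps)
        moreover have "finite J" using J I finite_subset by blast
        ultimately show "\<exists>f. spanning_linkage H' E J A' B' f"
          using 3(2) AB' big' by (intro spanning_linkage_exists[OF tourn_subset[OF TH H'(1)] _ J(2) _ H'(2)]) auto
      qed
      then obtain f where "spanning_linkage H E I A B f" by blast
      thus ?thesis by (rule good)
    qed
  qed
  then obtain f where f: "\<And>i. i \<in> I \<Longrightarrow> distinct (f i) \<and> set (f i) \<subseteq> H \<and> successively E (x i # f i @ [y i])"
    and fd: "\<And>i j. i \<in> I \<Longrightarrow> j \<in> I \<Longrightarrow> i \<noteq> j \<Longrightarrow> set (f i) \<inter> set (f j) = {}"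
    and fH: "(\<Union>i\<in>I. set (f i)) = H" by metis
  have xyZ: "x i \<in> Z" "y i \<in> Z" if "i \<in> I" for i using that by (auto simp: Z_def)
  define P where "P i = x i # f i @ [y i]" for i
  have setP: "set (P i) = {x i, y i} \<union> set (f i)" for i by (auto simp: P_def)
  have HZ: "H \<inter> Z = {}" by (auto simp: H_def)
  show ?thesis
    unfolding I_def[symmetric] Z_def[symmetric]
  proof (intro exI[of _ P] conjI ballI impI)
    fix i assume i: "i \<in> I"
    have "x i \<notin> set (f i)" "y i \<notin> set (f i)" using f[OF i] xyZ[OF i] HZ by auto
    hence "distinct (P i)" using f[OF i] xyV[OF i] by (simp add: P_def)
    moreover have "set (P i) \<subseteq> V" using f[OF i] xyV[OF i] HV by (auto simp: setP)
    moreover have "\<forall>j. Suc j < length (P i) \<longrightarrow> E (P i ! j) (P i ! Suc j)"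
      using f[OF i] unfolding P_def successively_conv_nth by blast
    ultimately show "dpath_from_to V E (P i) (x i) (y i)"
      unfolding dpath_from_to_def dpath_def by (simp add: P_def)
    show "Z \<inter> set (P i) = {x i, y i}" using f[OF i] xyZ[OF i] HZ by (auto simp: setP)
    fix j assume j: "j \<in> I" "i \<noteq> j"
    have "interior (P i) = set (f i)" by (simp add: interior_def P_def)
    thus "interior (P i) \<inter> set (P j) = {}"
      using fd[OF i j] f[OF i] xyZ[OF j(1)] HZ by (auto simp: setP)
  next
    have "(\<Union>i\<in>I. set (P i)) = Z \<union> (\<Union>i\<in>I. set (f i))" by (auto simp: setP Z_def)
    thus "V = (\<Union>i\<in>I. set (P i))" using ZV fH by (auto simp: H_def)
  qed
qed

end
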